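(* Let $n\ge2$, let $B$ be the open unit ball of $\mathbb{R}^n$ centered at $0$, let $\psi\in C_0^\infty(\mathbb{R}^n)$ with $\operatorname{supp}\psi\subseteq B$ and $\psi\not\equiv0$, and let $\Omega\subset\mathbb{R}^n$ be a bounded open set star-shaped with respect to every point of $\overline B$. Let $q>n$ and $F\in L^q(\Omega)$. Let $\eta\in C^\infty(\mathbb{R}^+)$ with $\eta\equiv0$ on $[0,1]$, $\eta(t)=1$ for $t\ge2$, and $|\eta'(t)|\le2$ for all $t$. Define $$N(x,y)=(x-y)\int_1^\infty\psi(y+\alpha(x-y))\alpha^{n-1}d\alpha,\quad v(x)=\int_\Omega F(y)N(x,y)\,dy,\quad v^\epsilon(x)=\int_\Omega F(y)N(x,y)\,\eta\Big(\frac{|x-y|}{\epsilon}\Big)dy$$ for $x\in\mathbb{R}^n$, $\epsilon>0$. Then: (i) if in addition $F\in L^\infty(\Omega)$, then $v^\epsilon\to v$ uniformly on $\mathbb{R}^n$ as $\epsilon\to0$; (ii) if moreover $\int_{\mathbb{R}^n}\psi=1$ and $F\in C^0(\overline\Omega)$, then for every $x\in\Omega$, $$\lim_{\epsilon\to0}\operatorname{div}v^\epsilon(x)=-\psi(x)\int_\Omega F(y)\,dy+F(x).$$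
   Context: $\Omega$ is star-shaped with respect to a point $p$ if $p\in\Omega$ and for every $y\in\Omega$ the segment joining $p$ and $y$ lies in $\Omega$. The functions $v^\epsilon$ belong to $C^\infty(\mathbb{R}^n)$. *)

theory Defs
  imports "HOL-Analysis.Analysis"
begin

fun partials :: "nat \<Rightarrow> (real^'n \<Rightarrow> real) \<Rightarrow> (real^'n \<Rightarrow> real) set" where
  "partials 0 f = {f}"
| "partials (Suc k) f =
     {(\<lambda>x. frechet_derivative g (at x) (axis i 1)) | g i. g \<in> partials k f}"

definition smooth_on :: "(real^'n) set \<Rightarrow> (real^'n \<Rightarrow> real) \<Rightarrow> bool" where
  "smooth_on S f \<longleftrightarrow> (\<forall>k. \<forall>g \<in> partials k f. \<forall>x\<in>S. g differentiable (at x))"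

definition smooth_on_real :: "real set \<Rightarrow> (real \<Rightarrow> real) \<Rightarrow> bool" where
  "smooth_on_real S f \<longleftrightarrow> (\<forall>k. \<forall>x\<in>S. ((deriv ^^ k) f) differentiable (at x))"

definition star_shaped_wrt :: "'a::real_vector set \<Rightarrow> 'a \<Rightarrow> bool" where
  "star_shaped_wrt \<Omega> p \<longleftrightarrow> p \<in> \<Omega> \<and> (\<forall>y\<in>\<Omega>. closed_segment p y \<subseteq> \<Omega>)"

definition divergence :: "(real^'n \<Rightarrow> real^'n) \<Rightarrow> real^'n \<Rightarrow> real" where
  "divergence v x = (\<Sum>i\<in>UNIV. frechet_derivative (\<lambda>y. v y $ i) (at x) (axis i 1))"

definition kernelN :: "(real^'n \<Rightarrow> real) \<Rightarrow> real^'n \<Rightarrow> real^'n \<Rightarrow> real^'n" where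
  "kernelN \<psi> x y = (LINT \<alpha>:{1..}|lborel. \<psi> (y + \<alpha> *\<^sub>R (x - y)) * \<alpha> ^ (CARD('n) - 1)) *\<^sub>R (x - y)"

end

(*
The regularized kernel N(x,y) eta(|x-y|/eps) vanishes near the diagonal, and for y in a bounded set
the integral defining N may then be cut at alpha = (1+R)/eps, since psi vanishes beyond. Hence it is
Lipschitz in x uniformly in y, and v^eps may be differentiated under the integral sign.

(i) holds because |N(x,y)| <= C |x-y|^(1-n), whose integral over a ball of radius 2 eps is O(eps).

(ii) n psi alpha^(n-1) + alpha^n grad psi . (x-y) is the alpha-derivative of
alpha^n psi(y+alpha(x-y)), so div_x N = -psi(x) off the diagonal, and
  div v^eps(x) = - psi(x) int F eta(|x-y|/eps) dy + int F eta'(|x-y|/eps) |x-y|/eps J(x,y) dy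
with N = (x-y) J. In the second term put y = x - eps z and alpha = 1 + s/eps: it becomes
  int F(x - eps z) eta'(|z|) |z| int_0^infty psi(x+sz) (eps+s)^(n-1) ds dz,
which tends to F(x) int eta'(|z|) |z| int_0^infty psi(x+sz) s^(n-1) ds dz. By Fubini and w = s z
this is F(x) times int psi(x+w) int_0^infty eta'(|w|/s) |w|/s^2 ds dw = int psi, the inner integral being 1.
*)

theory Submission
  imports Defs
begin

subsection \<open>Differentiation under the integral sign\<close>

text \<open>The gradient of N(x, y) in x can grow like |x - y|^(-n), which is not integrable near y
  = x, so v itself cannot be differentiated under the integral sign; the cutoff removes this
  obstacle. Its price is the term with eta', carried by the shell eps <= |x - y| <= 2 eps. There J
  is of order eps^(-n) while the shell has volume of order eps^n, so the term neither blows up nor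
  disappears: it is the source of F(x). The level (1 + R) / eps comes from the support of psi: if
  |y| <= R and |x - y| >= eps, then beyond this level y + alpha (x - y) has norm at least (1 + R) -
  R = 1. The truncated integral runs over a bounded interval, hence is differentiable in x
  everywhere, the diagonal included, with constants that do not depend on y. In (ii) F is extended
  by zero to a bounded Borel function on the whole space; the extension is continuous at x because
  Omega is open.\<close>

text \<open>Integrability of \<open>f\<close> is not assumed: otherwise its integral is 0, while
  \<open>g\<close> is nonnegative as a bound of norms.\<close>

lemma norm_lebesgue_integral_le:
  fixes f :: "'m \<Rightarrow> 'b::{banach,second_countable_topology}"
  assumes "integrable M g" "\<And>x. x \<in> space M \<Longrightarrow> norm (f x) \<le> g x"
  shows "norm (\<integral>x. f x \<partial>M) \<le> (\<integral>x. g x \<partial>M)"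
proof (rule order_trans[OF integral_norm_bound integral_mono'])
qed (use assms order_trans[OF norm_ge_zero] in blast)+

lemma has_vector_derivative_quotient:
  assumes "(g has_vector_derivative v) (at 0)"
  shows "((\<lambda>r. (1 / r) *\<^sub>R (g r - g 0)) \<longlongrightarrow> v) (at 0)"
proof -
  have "((\<lambda>r. norm (g r - g 0 - r *\<^sub>R v) / norm r) \<longlongrightarrow> 0) (at 0)"
    using assms by (simp add: has_vector_derivative_def has_derivative_at)
  moreover have "norm (g r - g 0 - r *\<^sub>R v) / norm r = norm ((1 / r) *\<^sub>R (g r - g 0) - v)" if "r \<noteq> 0" for r
  proof -
    have "(1 / r) *\<^sub>R (g r - g 0) - v = (1 / r) *\<^sub>R (g r - g 0 - r *\<^sub>R v)"
      using that by (simp add: scaleR_diff_right)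
    then show ?thesis by (simp add: divide_inverse mult.commute)
  qed
  then have "\<forall>\<^sub>F r in at 0. norm (g r - g 0 - r *\<^sub>R v) / norm r = norm ((1 / r) *\<^sub>R (g r - g 0) - v)"
    by (auto simp: eventually_at intro!: exI[of _ 1])
  ultimately have "((\<lambda>r. norm ((1 / r) *\<^sub>R (g r - g 0) - v)) \<longlongrightarrow> 0) (at 0)"
    by (rule Lim_transform_eventually)
  then show ?thesis
    by (rule LIM_zero_cancel[OF tendsto_norm_zero_cancel])
qed

text \<open>The Lipschitz bound compares only with the base point \<open>x\<close>. It dominates the
  difference quotients, and in the limit \<open>f'\<close> as well; measurability of
  \<open>f'\<close> also comes from that limit.\<close>

lemma
  fixes f :: "'a::real_normed_vector \<Rightarrow> 'm \<Rightarrow> 'b::{banach,second_countable_topology}"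
  assumes "0 < \<delta>"
    and int: "\<And>x'. norm (x' - x) < \<delta> \<Longrightarrow> integrable M (f x')"
    and der: "\<And>y. y \<in> space M \<Longrightarrow> ((\<lambda>x. f x y) has_derivative f' y) (at x)"
    and lip: "\<And>x' y. norm (x' - x) < \<delta> \<Longrightarrow> y \<in> space M \<Longrightarrow> norm (f x' y - f x y) \<le> g y * norm (x' - x)"
    and g: "integrable M g"
  shows integrable_derivative_dominated: "integrable M (\<lambda>y. f' y h)"
    and has_derivative_integral_dominated:
      "((\<lambda>x. \<integral>y. f x y \<partial>M) has_derivative (\<lambda>h. \<integral>y. f' y h \<partial>M)) (at x)"
proof -
  have bnd_int: "integrable M (\<lambda>y. f' y h) \<and> (\<forall>y\<in>space M. norm (f' y h) \<le> g y * norm h)" for h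
  proof -
    \<comment> \<open>Keeps \<open>x + t *\<^sub>R h\<close> in the ball of radius
      \<open>\<delta>\<close> for all 0 < t <= c; the added 1 covers \<open>h = 0\<close>.\<close>
    define c where "c = \<delta> / (norm h + 1)"
    have c: "c > 0" "c * norm h < \<delta>"
      using \<open>0 < \<delta>\<close> add_nonneg_pos[OF norm_ge_zero[of h] zero_less_one] by (simp_all add: c_def pos_divide_less_eq)
    define t where "t k = c / real (Suc k)" for k
    have t: "t k > 0" "t k \<le> c" for k using c by (auto simp: t_def divide_simps mult_le_cancel_left1)
    have t0: "t \<longlonglongrightarrow> 0" unfolding t_def by real_asymp
    have th: "norm (x + t k *\<^sub>R h - x) < \<delta>" for k
      using t[of k] c by (simp add: le_less_trans[OF mult_right_mono[of "t k" c "norm h"]])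
    define s where "s k y = (1 / t k) *\<^sub>R (f (x + t k *\<^sub>R h) y - f x y)" for k y
    have lim: "(\<lambda>k. s k y) \<longlonglongrightarrow> f' y h" if y: "y \<in> space M" for y
    proof -
      have "((\<lambda>r. f (x + r *\<^sub>R h) y) has_derivative (\<lambda>r. f' y (r *\<^sub>R h))) (at 0)"
        by (rule has_derivative_compose[of "\<lambda>r. x + r *\<^sub>R h" "\<lambda>r. r *\<^sub>R h" 0 UNIV "\<lambda>x. f x y", simplified])
           (auto intro!: derivative_eq_intros der y)
      then have "((\<lambda>r. f (x + r *\<^sub>R h) y) has_vector_derivative f' y h) (at 0)"
        using linear_cmul[OF has_derivative_linear[OF der[OF y]]]
        by (simp add: has_vector_derivative_def)
      then have "((\<lambda>r. (1 / r) *\<^sub>R (f (x + r *\<^sub>R h) y - f x y)) \<longlongrightarrow> f' y h) (at 0)"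
        using has_vector_derivative_quotient[of "\<lambda>r. f (x + r *\<^sub>R h) y"] by simp
      moreover have "filterlim t (at 0) sequentially"
        using t(1) t0 by (simp add: filterlim_at less_imp_neq[symmetric] order_less_imp_not_eq2)
      ultimately show ?thesis
        unfolding s_def by (rule filterlim_compose[of "\<lambda>r. (1 / r) *\<^sub>R (f (x + r *\<^sub>R h) y - f x y)"])
    qed
    have sb: "norm (s k y) \<le> g y * norm h" if "y \<in> space M" for k y
      using lip[OF th that, of k] t[of k] by (simp add: s_def divide_simps mult_ac)
    have xint: "integrable M (s k)" for k
      unfolding s_def using int[OF th[of k]] int[of x] \<open>0<\<delta>\<close> by auto
    have f'm: "(\<lambda>y. f' y h) \<in> borel_measurable M"
      using borel_measurable_LIMSEQ_metric[of s M "\<lambda>y. f' y h"] lim xint by auto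
    show ?thesis
      using integrable_dominated_convergence[OF f'm, of s "\<lambda>y. g y * norm h"] xint g sb lim
      by (auto intro: tendsto_upperbound[OF tendsto_norm[OF lim]])
  qed
  then show "integrable M (\<lambda>y. f' y h)" by auto
  have i': "integrable M (\<lambda>y. f' y h)" for h using bnd_int by auto
  have intx: "integrable M (f x)" using int[of x] \<open>0<\<delta>\<close> by simp
  show "((\<lambda>x. \<integral>y. f x y \<partial>M) has_derivative (\<lambda>h. \<integral>y. f' y h \<partial>M)) (at x)"
    unfolding has_derivative_at
  proof
    note lin = has_derivative_linear[OF der]
    show "bounded_linear (\<lambda>h. \<integral>y. f' y h \<partial>M)"
    proof (rule bounded_linear_intro)
      show "(\<integral>y. f' y (a + b) \<partial>M) = (\<integral>y. f' y a \<partial>M) + (\<integral>y. f' y b \<partial>M)" for a b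
        by (subst Bochner_Integration.integral_add[symmetric, OF i' i'])
           (intro Bochner_Integration.integral_cong refl linear_add lin)
      show "(\<integral>y. f' y (r *\<^sub>R a) \<partial>M) = r *\<^sub>R (\<integral>y. f' y a \<partial>M)" for r a
      proof -
        have "(\<integral>y. f' y (r *\<^sub>R a) \<partial>M) = (\<integral>y. r *\<^sub>R f' y a \<partial>M)"
          by (intro Bochner_Integration.integral_cong refl linear_cmul lin)
        then show ?thesis using i' by simp
      qed
      show "norm (\<integral>y. f' y a \<partial>M) \<le> norm a * (\<integral>y. g y \<partial>M)" for a
      proof -
        have "norm (\<integral>y. f' y a \<partial>M) \<le> (\<integral>y. g y * norm a \<partial>M)"
          using bnd_int[of a] g by (intro norm_lebesgue_integral_le) auto
        then show ?thesis by (simp add: mult.commute)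
      qed
    qed
    show "(\<lambda>h. norm ((\<integral>y. f (x + h) y \<partial>M) - (\<integral>y. f x y \<partial>M) - (\<integral>y. f' y h \<partial>M)) / norm h) \<midarrow>0\<rightarrow> 0"
      unfolding tendsto_at_iff_sequentially
    proof (intro allI impI)
      fix X :: "nat \<Rightarrow> 'a" assume X: "\<forall>i. X i \<in> UNIV - {0}" and X0: "X \<longlonglongrightarrow> 0"
      then have ev: "\<forall>\<^sub>F k in sequentially. norm (X k) < \<delta>"
        using \<open>0 < \<delta>\<close> order_tendstoD(2)[OF tendsto_norm[OF X0]] by simp
      \<comment> \<open>Dominated convergence speaks about every term of a sequence, so the finitely
        many \<open>X k\<close> outside the ball of radius \<open>\<delta>\<close> are shifted
        away.\<close>
      then obtain N where N: "\<And>k. norm (X (k + N)) < \<delta>"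
        unfolding eventually_sequentially by (metis le_add2)
      define q where "q k y = (1 / norm (X (k + N))) *\<^sub>R (f (x + X (k + N)) y - f x y - f' y (X (k + N)))" for k y
      have nz: "norm (X k) > 0" for k using X by auto
      have qi: "integrable M (q k)" for k
        unfolding q_def using i' intx int[of "x + X (k + N)"] N by auto
      have "(\<lambda>k. \<integral>y. q k y \<partial>M) \<longlonglongrightarrow> (\<integral>y. 0 \<partial>M)"
      proof (rule integral_dominated_convergence)
        \<comment> \<open>One \<open>g\<close> for the difference quotient, one for the linear
          term.\<close>
        show "integrable M (\<lambda>y. 2 * g y)" using g by simp
        show "AE y in M. (\<lambda>k. q k y) \<longlonglongrightarrow> 0"
        proof (rule AE_I2)
          fix y assume y: "y \<in> space M"
          have "(\<lambda>h. norm (f (x + h) y - f x y - f' y h) / norm h) \<midarrow>0\<rightarrow> 0"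
            using der[OF y] unfolding has_derivative_at by auto
          then have "(\<lambda>k. norm (f (x + X k) y - f x y - f' y (X k)) / norm (X k)) \<longlonglongrightarrow> 0"
            using X X0 unfolding tendsto_at_iff_sequentially o_def by blast
          then have "(\<lambda>k. norm (f (x + X (k+N)) y - f x y - f' y (X (k+N))) / norm (X (k+N))) \<longlonglongrightarrow> 0"
            by (rule LIMSEQ_ignore_initial_segment)
          then show "(\<lambda>k. q k y) \<longlonglongrightarrow> 0"
            by (subst tendsto_norm_zero_iff[symmetric]) (simp add: q_def)
        qed
        show "AE y in M. norm (q k y) \<le> 2 * g y" for k
        proof (rule AE_I2)
          fix y assume y: "y \<in> space M"
          have "norm (f (x + X (k+N)) y - f x y - f' y (X (k+N))) \<le> 2 * g y * norm (X (k+N))"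
            using lip[of "x + X (k+N)" y] N[of k] y bnd_int[of "X (k+N)"]
              norm_triangle_ineq4[of "f (x + X (k+N)) y - f x y" "f' y (X (k+N))"] by force
          then show "norm (q k y) \<le> 2 * g y"
            using nz[of "k+N"] by (simp add: q_def divide_simps mult_ac)
        qed
      qed (use qi in auto)
      then have "(\<lambda>k. norm (\<integral>y. q k y \<partial>M)) \<longlonglongrightarrow> 0"
        by (simp add: tendsto_norm_zero)
      moreover have "norm (\<integral>y. q k y \<partial>M) = norm ((\<integral>y. f (x + X (k+N)) y \<partial>M) - (\<integral>y. f x y \<partial>M) - (\<integral>y. f' y (X (k+N)) \<partial>M)) / norm (X (k+N))" for k
        using i' intx int[of "x + X (k + N)"] N unfolding q_def by auto
      ultimately show "((\<lambda>h. norm ((\<integral>y. f (x + h) y \<partial>M) - (\<integral>y. f x y \<partial>M) - (\<integral>y. f' y h \<partial>M)) / norm h) \<circ> X) \<longlonglongrightarrow> 0"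
        using LIMSEQ_offset[where k=N and f="\<lambda>k. norm ((\<integral>y. f (x + X k) y \<partial>M) - (\<integral>y. f x y \<partial>M) - (\<integral>y. f' y (X k) \<partial>M)) / norm (X k)"]
        by (simp add: o_def)
    qed
  qed
qed

subsection \<open>The singularity \<open>norm (x - y) ^ (1 - n)\<close>\<close>

text \<open>Picks the dyadic shell containing \<open>s\<close>, so that a singular function of
  \<open>s\<close> can be compared with constants on shrinking balls.\<close>

lemma dyadic_scale:
  fixes s r :: real
  assumes "0 < s" "s < r"
  obtains k where "s < r / 2 ^ k" "r / 2 ^ Suc k \<le> s"
proof -
  have "\<exists>k. r / 2 ^ k \<le> s"
  proof -
    obtain k where "r / s < 2 ^ k" using real_arch_pow[of 2 "r / s"] by auto
    then have "r / 2 ^ k \<le> s" using assms by (simp add: field_simps)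
    then show ?thesis by blast
  qed
  define k where "k = (LEAST k. r / 2 ^ k \<le> s)"
  have k: "r / 2 ^ k \<le> s" unfolding k_def by (rule LeastI_ex) fact
  then have "k \<noteq> 0" using assms by (intro notI) auto
  then obtain j where j: "k = Suc j" by (cases k) auto
  then have "\<not> r / 2 ^ j \<le> s"
    using not_less_Least[of j "\<lambda>k. r / 2 ^ k \<le> s"] k_def by auto
  with k j show thesis by (intro that[of j]) auto
qed

text \<open>At \<open>y = x\<close> the integrand is \<open>1 / 0 = 0\<close>.\<close>

lemma nn_integral_singular_kernel_ball:
  fixes x :: "real^'n"
  assumes r: "0 \<le> r"
  shows "(\<integral>\<^sup>+y. ennreal (indicator (ball x r) y * (1 / norm (x - y) ^ (CARD('n) - 1))) \<partial>lborel)
         \<le> ennreal (unit_ball_vol (real CARD('n)) * 2 ^ CARD('n) * r)"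
proof (cases "r = 0")
  case False
  define m where "m = CARD('n) - 1"
  have n: "CARD('n) = Suc m" using zero_less_card_finite[where 'a='n] by (simp add: m_def del: zero_less_card_finite)
  define V where "V = unit_ball_vol (real CARD('n))"
  have V: "V \<ge> 0" by (simp add: V_def)
  from False r have r: "0 < r" by simp
  have [measurable]: "ball x s \<in> sets borel" for s by simp
  \<comment> \<open>On the shell r / 2^(k+1) <= |x - y| < r / 2^k the singularity is at most the
    constant of \<open>g k\<close>. The integral of \<open>g k\<close> over its ball is V 2^m r /
    2^k, a geometric series with sum V 2^(m+1) r.\<close>
  define g where "g k y = ennreal ((2 ^ Suc k / r) ^ m) * indicator (ball x (r / 2 ^ k)) y" for k y
  have "ennreal (indicator (ball x r) y * (1 / norm (x - y) ^ m)) \<le> (\<Sum>k. g k y)" for y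
  proof (cases "y \<in> ball x r \<and> y \<noteq> x")
    case True
    then have "0 < norm (x - y)" "norm (x - y) < r" by (auto simp: dist_norm)
    then obtain k where k: "norm (x - y) < r / 2 ^ k" "r / 2 ^ Suc k \<le> norm (x - y)"
      by (rule dyadic_scale)
    have "1 / norm (x - y) \<le> 2 ^ Suc k / r"
      using k(2) r \<open>0 < norm (x - y)\<close> by (simp add: field_simps)
    then have "(1 / norm (x - y)) ^ m \<le> (2 ^ Suc k / r) ^ m"
      by (intro power_mono) auto
    then have "ennreal (indicator (ball x r) y * (1 / norm (x - y) ^ m)) \<le> g k y"
      using True k(1) by (simp add: g_def power_divide dist_norm ennreal_leI)
    also have "\<dots> \<le> (\<Sum>k. g k y)"
      using sum_le_suminf[of "\<lambda>k. g k y" "{k}"] by simp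
    finally show ?thesis .
  next
    case False
    \<comment> \<open>For \<open>m = 0\<close> the value at \<open>y = x\<close> is 1 because 0 ^ 0
      = 1, and the term k = 0 dominates it.\<close>
    then show ?thesis
      by (cases m) (auto simp: g_def intro!: order_trans[OF _ sum_le_suminf[of _ "{0}"]] simp: r indicator_def)
  qed
  then have "(\<integral>\<^sup>+y. ennreal (indicator (ball x r) y * (1 / norm (x - y) ^ m)) \<partial>lborel) \<le> (\<integral>\<^sup>+y. (\<Sum>k. g k y) \<partial>lborel)"
    by (intro nn_integral_mono) auto
  also have "\<dots> = (\<Sum>k. \<integral>\<^sup>+y. g k y \<partial>lborel)"
    unfolding g_def by (intro nn_integral_suminf) measurable
  also have "\<dots> = (\<Sum>k. ennreal (V * 2 ^ m * r * (1 / 2) ^ k))"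
  proof (rule suminf_cong)
    fix k
    have "(\<integral>\<^sup>+y. g k y \<partial>lborel) = ennreal ((2 ^ Suc k / r) ^ m) * ennreal (V * (r / 2 ^ k) ^ Suc m)"
      unfolding g_def using emeasure_ball[of "r / 2 ^ k" x] r n
      by (subst nn_integral_cmult_indicator) (auto simp: V_def)
    also have "\<dots> = ennreal ((2 ^ Suc k / r) ^ m * (V * (r / 2 ^ k) ^ Suc m))"
      using V r by (subst ennreal_mult) auto
    also have "(2 ^ Suc k / r) ^ m * (V * (r / 2 ^ k) ^ Suc m) = V * (2 ^ Suc k / r * (r / 2 ^ k)) ^ m * (r / 2 ^ k)"
      by (simp only: power_mult_distrib power_Suc mult_ac)
    also have "2 ^ Suc k / r * (r / 2 ^ k) = 2" using r by simp
    finally show "(\<integral>\<^sup>+y. g k y \<partial>lborel) = ennreal (V * 2 ^ m * r * (1 / 2) ^ k)"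
      by (simp add: power_divide)
  qed
  also have "\<dots> = ennreal (\<Sum>k. V * 2 ^ m * r * (1 / 2) ^ k)"
    using V r by (intro suminf_ennreal2) (auto intro!: summable_mult summable_geometric)
  also have "(\<Sum>k. V * 2 ^ m * r * (1 / 2) ^ k) = V * 2 ^ CARD('n) * r"
    by (subst suminf_mult) (auto simp: suminf_geometric n)
  finally show ?thesis by (simp add: V_def m_def)
qed simp

lemma
  fixes x :: "real^'n"
  assumes "0 \<le> r"
  shows integrable_singular_kernel_ball:
      "integrable lborel (\<lambda>y. indicator (ball x r) y * (1 / norm (x - y) ^ (CARD('n) - 1)))"
    and integral_singular_kernel_ball_le:
      "(\<integral>y. indicator (ball x r) y * (1 / norm (x - y) ^ (CARD('n) - 1)) \<partial>lborel)
         \<le> unit_ball_vol (real CARD('n)) * 2 ^ CARD('n) * r"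
proof -
  have [measurable]: "ball x r \<in> sets borel" by simp
  note * = nn_integral_singular_kernel_ball[OF assms, of x]
  show "integrable lborel (\<lambda>y. indicator (ball x r) y * (1 / norm (x - y) ^ (CARD('n) - 1)))"
  proof (rule integrableI_nonneg)
    show "(\<lambda>y. indicator (ball x r) y * (1 / norm (x - y) ^ (CARD('n) - 1))) \<in> borel_measurable lborel"
      by measurable
  qed (use * in \<open>auto simp: le_less_trans\<close>)
  show "(\<integral>y. indicator (ball x r) y * (1 / norm (x - y) ^ (CARD('n) - 1)) \<partial>lborel)
         \<le> unit_ball_vol (real CARD('n)) * 2 ^ CARD('n) * r"
    using * assms by (intro integral_real_bounded) auto
qed

subsection \<open>The radial integral of the bump function\<close>

text \<open>The length of the interval is replaced by \<open>A\<close>, so that the bound also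
  covers the empty interval for \<open>A < 1\<close>.\<close>

lemma norm_integral_Icc_le:
  fixes f :: "real \<Rightarrow> real"
  assumes "0 \<le> A" "0 \<le> C" and f: "\<And>\<alpha>. 1 \<le> \<alpha> \<Longrightarrow> \<alpha> \<le> A \<Longrightarrow> \<bar>f \<alpha>\<bar> \<le> C"
  shows "\<bar>LINT \<alpha>:{1..A}|lborel. f \<alpha>\<bar> \<le> C * A"
proof -
  have "norm (LINT \<alpha>:{1..A}|lborel. f \<alpha>) \<le> (\<integral>\<alpha>. C * indicator {1..A} \<alpha> \<partial>lborel)"
    unfolding set_lebesgue_integral_def
  proof (rule norm_lebesgue_integral_le)
    show "integrable lborel (\<lambda>\<alpha>. C * indicator {1..A} \<alpha>)"
      by (intro integrable_mult_right integrable_real_indicator) (auto simp: emeasure_lborel_Icc_eq)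
    show "norm (indicator {1..A} \<alpha> *\<^sub>R f \<alpha>) \<le> C * indicator {1..A} \<alpha>" for \<alpha>
      using f[of \<alpha>] by (auto split: split_indicator)
  qed
  also have "\<dots> \<le> C * A"
    using assms by (cases "1 \<le> A") (auto intro!: mult_left_mono)
  finally show ?thesis by simp
qed

lemma power_card_eq: "a ^ CARD('n::finite) = a * (a :: real) ^ (CARD('n) - 1)"
  using power_minus_mult[of "CARD('n)" a] by (simp add: mult.commute)

locale bump =
  fixes \<psi> :: "real^'n \<Rightarrow> real" and \<psi>' :: "real^'n \<Rightarrow> real^'n" and B L :: real
  assumes zero_outside: "1 \<le> norm p \<Longrightarrow> \<psi> p = 0"
    and has_gradient: "(\<psi> has_derivative (\<lambda>h. \<psi>' p \<bullet> h)) (at p)"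
    and continuous_gradient: "continuous_on UNIV \<psi>'"
    and bound: "\<bar>\<psi> p\<bar> \<le> B"
    and gradient_bound: "norm (\<psi>' p) \<le> L"
begin

text \<open>For x = y the integrand is psi(y) alpha^(n-1), so the integral is 0, either because
  psi(y) = 0 or as the default value of a divergent integral; in \<open>kernelN\<close> it is
  multiplied by \<open>x - y = 0\<close> anyway.\<close>

definition J :: "real^'n \<Rightarrow> real^'n \<Rightarrow> real" where
  "J x y = (LINT \<alpha>:{1..}|lborel. \<psi> (y + \<alpha> *\<^sub>R (x - y)) * \<alpha> ^ (CARD('n) - 1))"

definition Jtr :: "real \<Rightarrow> real^'n \<Rightarrow> real^'n \<Rightarrow> real" where
  "Jtr A x y = (LINT \<alpha>:{1..A}|lborel. \<psi> (y + \<alpha> *\<^sub>R (x - y)) * \<alpha> ^ (CARD('n) - 1))"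

text \<open>The derivative of \<open>Jtr\<close> in x along \<open>h\<close>: since x enters through
  \<open>\<alpha> *\<^sub>R (x - y)\<close>, the power rises from n - 1 to n.\<close>

definition Jtr_deriv :: "real \<Rightarrow> real^'n \<Rightarrow> real^'n \<Rightarrow> real^'n \<Rightarrow> real" where
  "Jtr_deriv A x y h = (LINT \<alpha>:{1..A}|lborel. (\<psi>' (y + \<alpha> *\<^sub>R (x - y)) \<bullet> h) * \<alpha> ^ CARD('n))"

lemma kernelN_eq: "kernelN \<psi> x y = J x y *\<^sub>R (x - y)"
  by (simp add: kernelN_def J_def)

lemma continuous: "continuous_on S \<psi>"
  by (intro continuous_at_imp_continuous_on ballI has_derivative_continuous[OF has_gradient])

lemma measurable_psi [measurable]: "\<psi> \<in> borel_measurable borel"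
  by (intro borel_measurable_continuous_onI continuous)

lemma measurable_gradient [measurable]: "\<psi>' \<in> borel_measurable borel"
  by (intro borel_measurable_continuous_onI continuous_gradient)

lemma B_nonneg: "0 \<le> B"
  using bound[of 0] by linarith

lemma L_nonneg: "0 \<le> L"
  by (rule order_trans[OF norm_ge_zero gradient_bound])

lemma lipschitz: "\<bar>\<psi> p - \<psi> p'\<bar> \<le> L * norm (p - p')"
proof -
  have "norm (\<psi> p - \<psi> p') \<le> L * norm (p - p')"
  proof (rule differentiable_bound[of UNIV \<psi> "\<lambda>p h. \<psi>' p \<bullet> h"])
    show "onorm (\<lambda>h. \<psi>' p \<bullet> h) \<le> L" for p
      using gradient_bound[of p] by (intro onorm_le)
        (metis Cauchy_Schwarz_ineq2 mult_right_mono norm_ge_zero order_trans real_norm_def)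
  qed (use has_gradient in auto)
  then show ?thesis by simp
qed

lemma measurable_J [measurable]: "(\<lambda>y. J x y) \<in> borel_measurable borel"
  unfolding J_def set_lebesgue_integral_def by measurable

lemma measurable_Jtr [measurable]: "(\<lambda>y. Jtr A x y) \<in> borel_measurable borel"
  unfolding Jtr_def set_lebesgue_integral_def by measurable

lemma vanishes_far_out:
  assumes "norm y \<le> R" "1 + R \<le> \<alpha> * norm (x - y)" "0 \<le> \<alpha>"
  shows "\<psi> (y + \<alpha> *\<^sub>R (x - y)) = 0"
proof (rule zero_outside)
  have "\<alpha> * norm (x - y) - norm y \<le> norm (y + \<alpha> *\<^sub>R (x - y))"
    using norm_triangle_ineq2[of "\<alpha> *\<^sub>R (x - y)" "- y"] \<open>0 \<le> \<alpha>\<close> by (simp add: add.commute)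
  then show "1 \<le> norm (y + \<alpha> *\<^sub>R (x - y))" using assms by linarith
qed

lemma J_eq_Jtr:
  assumes "norm y \<le> R" "1 + R \<le> A * norm (x - y)" "0 \<le> A"
  shows "J x y = Jtr A x y"
  unfolding J_def Jtr_def set_lebesgue_integral_def
proof (rule Bochner_Integration.integral_cong[OF refl])
  fix \<alpha> :: real
  have "\<psi> (y + \<alpha> *\<^sub>R (x - y)) = 0" if "A < \<alpha>"
    using that assms by (intro vanishes_far_out[of y R])
      (auto intro: order_trans[OF _ mult_right_mono[of A \<alpha>]])
  then show "indicator {1..} \<alpha> *\<^sub>R (\<psi> (y + \<alpha> *\<^sub>R (x - y)) * \<alpha> ^ (CARD('n) - 1)) =
      indicator {1..A} \<alpha> *\<^sub>R (\<psi> (y + \<alpha> *\<^sub>R (x - y)) * \<alpha> ^ (CARD('n) - 1))"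
    by (auto simp: indicator_def)
qed

lemma Jtr_bound:
  assumes "0 \<le> A"
  shows "\<bar>Jtr A x y\<bar> \<le> B * A ^ CARD('n)"
proof -
  have "\<bar>Jtr A x y\<bar> \<le> (B * A ^ (CARD('n) - 1)) * A"
    unfolding Jtr_def
    by (rule norm_integral_Icc_le)
       (use assms B_nonneg bound in \<open>auto simp: abs_mult power_abs intro!: mult_mono power_mono\<close>)
  then show ?thesis
    by (simp add: power_card_eq mult_ac)
qed

text \<open>Here (1 + R) / |x - y| is the smallest level for which \<open>J_eq_Jtr\<close> applies,
  so \<open>Jtr_bound\<close> is used with it.\<close>

lemma J_bound:
  assumes "norm y \<le> R" "x \<noteq> y"
  shows "\<bar>J x y\<bar> \<le> B * ((1 + R) / norm (x - y)) ^ CARD('n)"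
proof -
  have "0 \<le> R" using assms norm_ge_zero order_trans by blast
  then show ?thesis
    using J_eq_Jtr[of y R "(1 + R) / norm (x - y)" x] Jtr_bound[of "(1 + R) / norm (x - y)" x y] assms by auto
qed

lemma integrable_Jtr:
  "set_integrable lborel {1..A} (\<lambda>\<alpha>. \<psi> (y + \<alpha> *\<^sub>R (x - y)) * \<alpha> ^ k)"
  by (intro borel_integrable_atLeastAtMost' continuous_intros continuous_on_compose2[OF continuous[of UNIV]]) auto

lemma integrable_Jtr_deriv:
  "set_integrable lborel {1..A} (\<lambda>\<alpha>. (\<psi>' (y + \<alpha> *\<^sub>R (x - y)) \<bullet> h) * \<alpha> ^ k)"
  by (intro borel_integrable_atLeastAtMost' continuous_intros continuous_on_compose2[OF continuous_gradient]) auto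

text \<open>Moving x by d moves the argument of \<open>\<psi>\<close> by \<open>\<alpha>\<close> d,
  hence the power n instead of n - 1.\<close>

lemma integrand_lipschitz:
  assumes "1 \<le> \<alpha>" "\<alpha> \<le> A"
  shows "\<bar>\<psi> (y + \<alpha> *\<^sub>R (x' - y)) * \<alpha> ^ (CARD('n) - 1) - \<psi> (y + \<alpha> *\<^sub>R (x - y)) * \<alpha> ^ (CARD('n) - 1)\<bar>
    \<le> L * A ^ CARD('n) * norm (x' - x)"
proof -
  have "\<bar>\<psi> (y + \<alpha> *\<^sub>R (x' - y)) - \<psi> (y + \<alpha> *\<^sub>R (x - y))\<bar> * \<alpha> ^ (CARD('n) - 1)
    \<le> (L * (\<alpha> * norm (x' - x))) * \<alpha> ^ (CARD('n) - 1)"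
    using lipschitz[of "y + \<alpha> *\<^sub>R (x' - y)" "y + \<alpha> *\<^sub>R (x - y)"] assms
    by (intro mult_right_mono) (auto simp flip: scaleR_diff_right)
  also have "\<dots> = L * \<alpha> ^ CARD('n) * norm (x' - x)"
    by (simp add: power_card_eq mult_ac)
  also have "\<dots> \<le> L * A ^ CARD('n) * norm (x' - x)"
    using assms L_nonneg by (intro mult_right_mono mult_left_mono power_mono) auto
  finally show ?thesis
    using assms by (simp add: abs_mult power_abs flip: left_diff_distrib)
qed

lemma Jtr_lipschitz:
  assumes "0 \<le> A"
  shows "\<bar>Jtr A x' y - Jtr A x y\<bar> \<le> L * A ^ Suc (CARD('n)) * norm (x' - x)"
proof -
  have "Jtr A x' y - Jtr A x y = (LINT \<alpha>:{1..A}|lborel. \<psi> (y + \<alpha> *\<^sub>R (x' - y)) * \<alpha> ^ (CARD('n) - 1)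
      - \<psi> (y + \<alpha> *\<^sub>R (x - y)) * \<alpha> ^ (CARD('n) - 1))"
    unfolding Jtr_def by (intro set_integral_diff(2)[symmetric] integrable_Jtr)
  also have "\<bar>\<dots>\<bar> \<le> (L * A ^ CARD('n) * norm (x' - x)) * A"
    using assms L_nonneg by (intro norm_integral_Icc_le integrand_lipschitz) auto
  finally show ?thesis by (simp add: mult_ac)
qed

lemma Jtr_has_derivative: "((\<lambda>x. Jtr A x y) has_derivative Jtr_deriv A x y) (at x)"
proof -
  have "((\<lambda>x. \<integral>\<alpha>. indicator {1..A} \<alpha> *\<^sub>R (\<psi> (y + \<alpha> *\<^sub>R (x - y)) * \<alpha> ^ (CARD('n) - 1)) \<partial>lborel) has_derivative
      (\<lambda>h. \<integral>\<alpha>. indicator {1..A} \<alpha> *\<^sub>R ((\<psi>' (y + \<alpha> *\<^sub>R (x - y)) \<bullet> h) * \<alpha> ^ CARD('n)) \<partial>lborel)) (at x)"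
  proof (rule has_derivative_integral_dominated)
    show "0 < (1::real)" by simp
    show "integrable lborel (\<lambda>\<alpha>. indicator {1..A} \<alpha> *\<^sub>R (\<psi> (y + \<alpha> *\<^sub>R (x' - y)) * \<alpha> ^ (CARD('n) - 1)))" for x'
      using integrable_Jtr unfolding set_integrable_def .
    show "((\<lambda>x. indicator {1..A} \<alpha> *\<^sub>R (\<psi> (y + \<alpha> *\<^sub>R (x - y)) * \<alpha> ^ (CARD('n) - 1))) has_derivative
        (\<lambda>h. indicator {1..A} \<alpha> *\<^sub>R ((\<psi>' (y + \<alpha> *\<^sub>R (x - y)) \<bullet> h) * \<alpha> ^ CARD('n)))) (at x)" for \<alpha>
    proof -
      have "((\<lambda>x. \<psi> (y + \<alpha> *\<^sub>R (x - y))) has_derivative (\<lambda>h. \<psi>' (y + \<alpha> *\<^sub>R (x - y)) \<bullet> (\<alpha> *\<^sub>R h))) (at x)"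
        by (rule has_derivative_compose[OF _ has_gradient]) (auto intro!: derivative_eq_intros)
      from has_derivative_scaleR_right[OF has_derivative_mult_left[OF this, of "\<alpha> ^ (CARD('n) - 1)"], of "indicator {1..A} \<alpha>"]
      show ?thesis by (simp add: power_card_eq mult_ac)
    qed
    show "norm (indicator {1..A} \<alpha> *\<^sub>R (\<psi> (y + \<alpha> *\<^sub>R (x' - y)) * \<alpha> ^ (CARD('n) - 1)) -
         indicator {1..A} \<alpha> *\<^sub>R (\<psi> (y + \<alpha> *\<^sub>R (x - y)) * \<alpha> ^ (CARD('n) - 1)))
       \<le> (L * A ^ CARD('n) * indicator {1..A} \<alpha>) * norm (x' - x)" for x' \<alpha>
      using integrand_lipschitz[of \<alpha> A y x' x] by (auto simp: indicator_def)
    show "integrable lborel (\<lambda>\<alpha>. L * A ^ CARD('n) * indicator {1..A} \<alpha>)"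
      by (intro integrable_mult_right integrable_real_indicator) (auto simp: emeasure_lborel_Icc_eq)
  qed
  then show ?thesis
    unfolding Jtr_def Jtr_deriv_def[abs_def] set_lebesgue_integral_def .
qed

text \<open>The integrand is the derivative of \<open>\<alpha> ^ n * \<psi> (y + \<alpha> *\<^sub>R (x - y))\<close>, which
  vanishes at the upper end \<open>A\<close>.\<close>

lemma Jtr_radial_identity:
  assumes "norm y \<le> R" "1 + R \<le> A * norm (x - y)" "1 \<le> A"
  shows "real CARD('n) * Jtr A x y + Jtr_deriv A x y (x - y) = - \<psi> x"
proof -
  define f where "f \<alpha> = real CARD('n) * (\<psi> (y + \<alpha> *\<^sub>R (x - y)) * \<alpha> ^ (CARD('n) - 1))
     + (\<psi>' (y + \<alpha> *\<^sub>R (x - y)) \<bullet> (x - y)) * \<alpha> ^ CARD('n)" for \<alpha>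
  have "real CARD('n) * Jtr A x y + Jtr_deriv A x y (x - y) = (LINT \<alpha>:{1..A}|lborel. f \<alpha>)"
    unfolding Jtr_def Jtr_deriv_def f_def
    by (subst set_integral_add(2)) (auto intro!: integrable_Jtr integrable_Jtr_deriv)
  also have "\<dots> = A ^ CARD('n) * \<psi> (y + A *\<^sub>R (x - y)) - 1 ^ CARD('n) * \<psi> (y + 1 *\<^sub>R (x - y))"
    unfolding set_lebesgue_integral_def
  proof (rule integral_FTC_atLeastAtMost[OF \<open>1 \<le> A\<close>])
    fix \<alpha> :: real
    have "((\<lambda>\<alpha>. \<psi> (y + \<alpha> *\<^sub>R (x - y))) has_derivative (\<lambda>h. \<psi>' (y + \<alpha> *\<^sub>R (x - y)) \<bullet> (h *\<^sub>R (x - y)))) (at \<alpha> within {1..A})"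
      by (rule has_derivative_compose[OF _ has_gradient]) (auto intro!: derivative_eq_intros)
    then have "((\<lambda>\<alpha>. \<psi> (y + \<alpha> *\<^sub>R (x - y))) has_real_derivative \<psi>' (y + \<alpha> *\<^sub>R (x - y)) \<bullet> (x - y)) (at \<alpha> within {1..A})"
      by (simp add: has_field_derivative_def mult_commute_abs)
    then show "((\<lambda>\<alpha>. \<alpha> ^ CARD('n) * \<psi> (y + \<alpha> *\<^sub>R (x - y))) has_vector_derivative f \<alpha>) (at \<alpha> within {1..A})"
      unfolding has_real_derivative_iff_has_vector_derivative[symmetric]
      by (auto intro!: derivative_eq_intros simp: f_def)
  next
    show "continuous_on {1..A} f" unfolding f_def
      by (intro continuous_intros continuous_on_compose2[OF continuous[of UNIV]] continuous_on_compose2[OF continuous_gradient]) auto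
  qed
  \<comment> \<open>The lower end \<open>\<alpha> = 1\<close> is the point y + (x - y) = x.\<close>
  also have "\<dots> = - \<psi> x"
    using vanishes_far_out[of y R A x] assms by simp
  finally show ?thesis .
qed

end

section \<open>Limits from the right, scaling of integrals, and traces\<close>

lemma integral_dominated_convergence_at_right:
  fixes s :: "real \<Rightarrow> 'a \<Rightarrow> 'b::{banach, second_countable_topology}"
  assumes meas: "f \<in> borel_measurable M" "\<And>t. s t \<in> borel_measurable M" "integrable M w"
    and lim: "AE x in M. ((\<lambda>t. s t x) \<longlongrightarrow> f x) (at_right 0)"
    and "0 < c" and bnd: "\<And>t x. 0 < t \<Longrightarrow> t < c \<Longrightarrow> norm (s t x) \<le> w x"
  shows "((\<lambda>t. \<integral>x. s t x \<partial>M) \<longlongrightarrow> (\<integral>x. f x \<partial>M)) (at_right (0::real))"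
  unfolding filterlim_at_right_to_top
proof (rule integral_dominated_convergence_at_top)
  show "\<forall>\<^sub>F t in at_top. AE x in M. norm (s (inverse t) x) \<le> w x"
    using eventually_gt_at_top[of "inverse c"] eventually_gt_at_top[of 0]
    by eventually_elim (use \<open>0 < c\<close> in \<open>auto intro!: bnd simp: field_simps\<close>)
  show "AE x in M. ((\<lambda>t. s (inverse t) x) \<longlongrightarrow> f x) at_top"
    using lim by (simp add: filterlim_at_right_to_top)
qed (use meas in auto)

text \<open>Measurability suffices: if \<open>f\<close> is not integrable, both sides are 0.\<close>

lemma lebesgue_integral_affine:
  fixes f :: "'a::euclidean_space \<Rightarrow> real"
  assumes [measurable]: "f \<in> borel_measurable borel" and "c \<noteq> 0"
  shows "(\<integral>x. f x \<partial>lborel) = \<bar>c\<bar> ^ DIM('a) * (\<integral>x. f (t + c *\<^sub>R x) \<partial>lborel)"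
  by (subst lborel_affine[OF \<open>c \<noteq> 0\<close>, of t])
     (simp add: integral_density integral_distr)

lemma divergence_eq:
  assumes "(v has_derivative D) (at x)"
  shows "divergence v x = (\<Sum>i\<in>UNIV. D (axis i 1) $ i)"
proof -
  have "((\<lambda>y. v y $ i) has_derivative (\<lambda>h. D h $ i)) (at x)" for i
    by (rule bounded_linear.has_derivative[OF bounded_linear_vec_nth assms])
  then have "frechet_derivative (\<lambda>y. v y $ i) (at x) = (\<lambda>h. D h $ i)" for i
    by (simp add: frechet_derivative_at[symmetric])
  then show ?thesis by (simp add: divergence_def)
qed

text \<open>The sum is the trace of the rank-one map that sends h to
  \<open>l h *\<^sub>R u\<close>.\<close>

lemma linear_sum_axis:
  fixes l :: "real^'n \<Rightarrow> real"
  assumes "linear l"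
  shows "(\<Sum>i\<in>UNIV. l (axis i 1) * u $ i) = l u"
proof -
  have "l u = l (\<Sum>i\<in>UNIV. u $ i *\<^sub>R axis i 1)"
    using basis_expansion[of u] by (simp add: scalar_mult_eq_scaleR)
  also have "\<dots> = (\<Sum>i\<in>UNIV. l (axis i 1) * u $ i)"
    by (simp add: linear_sum[OF assms] linear_cmul[OF assms] mult.commute)
  finally show ?thesis by simp
qed

subsection \<open>Cutoff functions\<close>

locale cutoff =
  fixes e e' :: "real \<Rightarrow> real"
  assumes has_deriv: "(e has_real_derivative e' t) (at t)"
    and continuous_deriv: "continuous_on UNIV e'"
    and deriv_bound: "\<bar>e' t\<bar> \<le> 2"
    and eq_0: "t \<le> 1 \<Longrightarrow> e t = 0"
    and eq_1: "2 \<le> t \<Longrightarrow> e t = 1"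
begin

lemma measurable_e [measurable]: "e \<in> borel_measurable borel"
  using has_deriv by (intro borel_measurable_continuous_onI continuous_at_imp_continuous_on) (auto intro: DERIV_isCont)

lemma measurable_e' [measurable]: "e' \<in> borel_measurable borel"
  by (intro borel_measurable_continuous_onI continuous_deriv)

lemma deriv_eq_0: "t < 1 \<or> 2 < t \<Longrightarrow> e' t = 0"
proof (elim disjE)
  assume "t < 1"
  then have "eventually (\<lambda>s. e s = 0) (nhds t)"
    by (intro eventually_mono[OF eventually_nhds_in_open[of "{..<1}"]] eq_0) auto
  then have "(e has_real_derivative 0) (at t)"
    by (subst DERIV_cong_ev[OF refl _ refl]) auto
  then show ?thesis using has_deriv DERIV_unique by blast
next
  assume "2 < t"
  then have "eventually (\<lambda>s. e s = 1) (nhds t)"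
    by (intro eventually_mono[OF eventually_nhds_in_open[of "{2<..}"]] eq_1) auto
  then have "(e has_real_derivative 0) (at t)"
    by (subst DERIV_cong_ev[OF refl _ refl]) auto
  then show ?thesis using has_deriv DERIV_unique by blast
qed

lemma e_lipschitz: "\<bar>e s - e t\<bar> \<le> 2 * \<bar>s - t\<bar>"
  using field_differentiable_bound[of UNIV e e' 2 s t] has_deriv deriv_bound by auto

text \<open>Values in [0,1] are not assumed. Between 1 and 2 the slope bound acts over a distance
  below 1, starting from \<open>e 1 = 0\<close>.\<close>

lemma e_bound: "\<bar>e t\<bar> \<le> 2"
proof -
  consider "t \<le> 1" | "1 < t" "t < 2" | "2 \<le> t" by linarith
  then show ?thesis
    using e_lipschitz[of t 1] eq_0[of 1] eq_0[of t] eq_1[of t] by cases auto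
qed

text \<open>The norm is not differentiable at 0, but there the cutoff vanishes on a whole ball, and
  the formula gives 0 too because the inner product does.\<close>

lemma e_norm_has_derivative:
  fixes z :: "'a::real_inner"
  assumes "0 < \<epsilon>"
  shows "((\<lambda>z. e (norm z / \<epsilon>)) has_derivative (\<lambda>h. e' (norm z / \<epsilon>) * ((z \<bullet> h) / (norm z * \<epsilon>)))) (at z)"
proof (cases "z = 0")
  case True
  have "((\<lambda>z. e (norm z / \<epsilon>)) has_derivative (\<lambda>h. 0)) (at (0::'a))"
  proof (rule has_derivative_transform_within[OF has_derivative_const[of 0] \<open>0 < \<epsilon>\<close>])
    show "0 = e (norm z / \<epsilon>)" if "dist z 0 < \<epsilon>" for z :: 'a
      using that \<open>0 < \<epsilon>\<close> by (intro eq_0[symmetric]) simp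
  qed simp
  then show ?thesis using True by simp
next
  case False
  have "((\<lambda>z. norm z / \<epsilon>) has_derivative (\<lambda>h. (z \<bullet> h) / (norm z * \<epsilon>))) (at z)"
    using has_derivative_mult_left[OF has_derivative_norm[OF False], of "inverse \<epsilon>"]
    by (simp add: sgn_div_norm inner_commute divide_inverse mult_ac)
  then show ?thesis
    by (rule has_derivative_compose[of "\<lambda>z. norm z / \<epsilon>" _ z UNIV, OF _ has_deriv[unfolded has_field_derivative_def]])
qed

end

lemma abs_mult_le: "\<bar>a\<bar> \<le> b \<Longrightarrow> \<bar>c\<bar> \<le> d \<Longrightarrow> \<bar>a * c\<bar> \<le> b * d" for a b c d :: real
  by (simp add: abs_mult mult_mono')

lemma integrable_indicator_cball: "integrable lborel (indicator (cball x r) :: 'a::euclidean_space \<Rightarrow> real)"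
  by (rule integrable_real_indicator[OF _ emeasure_bounded_finite[OF bounded_cball]]) simp

lemma integrable_const_Icc: "integrable lborel (\<lambda>s. k * indicator {a..b} (s::real) :: real)"
  by (intro integrable_mult_right integrable_real_indicator) (auto simp: emeasure_lborel_Icc_eq)

lemma ident_at_right_0: "((\<lambda>t. t) \<longlongrightarrow> 0) (at_right (0::real))"
  by (simp add: tendsto_ident_at)

lemma measurable_lebesgue_on_borel:
  "f \<in> borel_measurable borel \<Longrightarrow> f \<in> borel_measurable (lebesgue_on S)"
  by (intro measurable_restrict_space1 measurable_completion) simp

subsection \<open>Regularized potentials\<close>

text \<open>Levels 0 and 1 of \<open>partials\<close> make \<open>\<psi>\<close> differentiable with
  continuous gradient. Both vanish outside the closed unit ball, whose compactness yields the two
  bounds.\<close>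

lemma smooth_on_imp_bump:
  fixes \<psi> :: "real^'n \<Rightarrow> real"
  assumes smooth: "smooth_on UNIV \<psi>" and supp: "closure (support_on UNIV \<psi>) \<subseteq> ball 0 1"
  obtains \<psi>' B L where "bump \<psi> \<psi>' B L"
proof -
  define \<psi>' :: "real^'n \<Rightarrow> real^'n" where "\<psi>' p = (\<chi> i. frechet_derivative \<psi> (at p) (axis i 1))" for p
  have zero: "\<psi> p = 0" if "1 \<le> norm p" for p
  proof (rule ccontr)
    assume "\<psi> p \<noteq> 0"
    then have "p \<in> closure (support_on UNIV \<psi>)"
      by (intro subsetD[OF closure_subset]) (simp add: support_on_def)
    then show False using supp that by auto
  qed
  have "\<psi> differentiable (at p)" for p
    using smooth[unfolded smooth_on_def, rule_format, of \<psi> 0 p] by simp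
  then have frechet: "(\<psi> has_derivative frechet_derivative \<psi> (at p)) (at p)" for p
    by (simp add: frechet_derivative_works[symmetric])
  then have grad: "(\<psi> has_derivative (\<lambda>h. \<psi>' p \<bullet> h)) (at p)" for p
  proof -
    have "\<psi>' p \<bullet> h = frechet_derivative \<psi> (at p) h" for h
      using linear_sum_axis[OF has_derivative_linear[OF frechet], of p h] by (simp add: \<psi>'_def inner_vec_def)
    then show ?thesis using frechet by simp
  qed
  have "(\<lambda>p. frechet_derivative \<psi> (at p) (axis i 1)) differentiable (at p)" for i p
    using smooth[unfolded smooth_on_def, rule_format, of "\<lambda>p. frechet_derivative \<psi> (at p) (axis i 1)" "Suc 0" p] by auto
  then have cont': "continuous_on UNIV \<psi>'"
    unfolding \<psi>'_def
    by (intro continuous_on_vec_lambda continuous_at_imp_continuous_on ballI differentiable_imp_continuous_within)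
  have cont: "continuous_on UNIV \<psi>"
    by (intro continuous_at_imp_continuous_on ballI has_derivative_continuous[OF grad])
  have zero': "\<psi>' p = 0" if "1 < norm p" for p
  proof -
    have "(\<psi> has_derivative (\<lambda>h. 0)) (at p)"
    proof (rule has_derivative_transform_within_open[OF has_derivative_const[of 0]])
      show "open (- cball (0::real^'n) 1)" by (simp add: open_Compl)
      show "p \<in> - cball 0 1" using that by simp
    qed (use zero in auto)
    then have "(\<lambda>h. \<psi>' p \<bullet> h) = (\<lambda>h. 0)" by (rule has_derivative_unique[OF grad])
    then have "\<psi>' p \<bullet> \<psi>' p = 0" by metis
    then show ?thesis by simp
  qed
  have "\<exists>K. \<forall>p\<in>cball 0 1. norm (f p) \<le> K" if "continuous_on UNIV f" for f :: "real^'n \<Rightarrow> 'b::real_normed_vector"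
    using compact_imp_bounded[OF compact_continuous_image[OF continuous_on_subset[OF that, of "cball 0 1"] compact_cball]]
    unfolding bounded_iff by auto
  from this[OF cont] this[OF cont'] obtain B L where B: "\<And>p. p \<in> cball 0 1 \<Longrightarrow> \<bar>\<psi> p\<bar> \<le> B"
    and L: "\<And>p. p \<in> cball 0 1 \<Longrightarrow> norm (\<psi>' p) \<le> L"
    by (metis real_norm_def)
  have "0 \<le> B" "0 \<le> L" using B[of 0] L[of 0] by (auto intro: order_trans[OF norm_ge_zero] order_trans[OF abs_ge_zero])
  then have "\<bar>\<psi> p\<bar> \<le> B" "norm (\<psi>' p) \<le> L" for p
    using B[of p] L[of p] zero[of p] zero'[of p] by (cases "norm p \<le> 1"; simp)+
  then have "bump \<psi> \<psi>' B L"
    by unfold_locales (use zero grad cont' in auto)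
  then show thesis by (rule that)
qed

text \<open>Nothing is known about \<open>\<eta>\<close> on the negative reals; extended by \<open>0\<close> it is continuously
  differentiable everywhere because it vanishes on \<open>[0,1]\<close>.\<close>

lemma smooth_on_real_imp_cutoff:
  assumes smooth: "smooth_on_real {0<..} \<eta>" and eta0: "\<forall>t\<in>{0..1}. \<eta> t = 0"
    and eta1: "\<forall>t\<ge>2. \<eta> t = 1" and bound: "\<forall>t>0. \<bar>deriv \<eta> t\<bar> \<le> 2"
  shows "cutoff (\<lambda>t. if 0 < t then \<eta> t else 0) (\<lambda>t. if 0 < t then deriv \<eta> t else 0)"
    (is "cutoff ?e ?e'")
proof
  have DD: "(\<eta> has_real_derivative deriv \<eta> t) (at t)" if "0 < t" for t
    using smooth[unfolded smooth_on_real_def, rule_format, of t 0] that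
    by (simp add: DERIV_deriv_iff_real_differentiable)
  have e0: "?e t = 0" if "t \<le> 1" for t using that eta0 by auto
  have zero: "(?e has_real_derivative 0) (at t)" if "t < 1" for t
  proof -
    have "eventually (\<lambda>s. ?e s = 0) (nhds t)"
      by (rule eventually_mono[OF eventually_nhds_in_open[of "{..<1}"]]) (use that e0 in auto)
    then show ?thesis by (subst DERIV_cong_ev[OF refl _ refl]) auto
  qed
  have pos: "(?e has_real_derivative deriv \<eta> t) (at t)" if "0 < t" for t
  proof -
    have "eventually (\<lambda>s. ?e s = \<eta> s) (nhds t)"
      by (rule eventually_mono[OF eventually_nhds_in_open[of "{0<..}"]]) (use that in auto)
    then show ?thesis using DD[OF that] by (subst DERIV_cong_ev[OF refl _ refl]) auto
  qed
  \<comment> \<open>On (0,1) both \<open>pos\<close> and \<open>zero\<close> apply, so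
    \<open>deriv \<eta>\<close> vanishes there. Thus \<open>?e'\<close> is 0 on a neighbourhood of
    every t <= 0, which gives its continuity at those points.\<close>
  have e'0: "?e' t = 0" if "t < 1" for t
    using DERIV_unique[OF pos zero[OF that]] by auto
  show "(?e has_real_derivative ?e' t) (at t)" for t
    using zero[of t] pos[of t] by auto
  show "continuous_on UNIV ?e'"
  proof (intro continuous_at_imp_continuous_on ballI)
    fix t :: real
    show "isCont ?e' t"
    proof (cases "0 < t")
      case True
      have "isCont (deriv \<eta>) t"
        using smooth[unfolded smooth_on_real_def, rule_format, of t 1] True
        by (auto intro: differentiable_imp_continuous_within)
      moreover have "eventually (\<lambda>s. ?e' s = deriv \<eta> s) (nhds t)"
        by (rule eventually_mono[OF eventually_nhds_in_open[of "{0<..}"]]) (use True in auto)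
      ultimately show ?thesis using isCont_cong[of ?e' "deriv \<eta>" t] by simp
    next
      case False
      have "eventually (\<lambda>s. ?e' s = 0) (nhds t)"
        by (rule eventually_mono[OF eventually_nhds_in_open[of "{..<1}"]]) (use False e'0 in auto)
      then show ?thesis using isCont_cong[of ?e' "\<lambda>s. 0" t] by simp
    qed
  qed
  show "\<bar>?e' t\<bar> \<le> 2" for t using bound by auto
  show "?e t = 0" if "t \<le> 1" for t by (rule e0[OF that])
  show "?e t = 1" if "2 \<le> t" for t using that eta1 by auto
qed

section \<open>The regularized kernel and the divergence of its potential\<close>

locale bump_cutoff = bump \<psi> \<psi>' B L + cutoff e e'
  for \<psi> :: "real^'n \<Rightarrow> real" and \<psi>' :: "real^'n \<Rightarrow> real^'n" and B L :: real
    and e e' :: "real \<Rightarrow> real"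
begin

text \<open>The kernel of v^eps, that is N(x, y) times the cutoff.\<close>

definition K :: "real \<Rightarrow> real^'n \<Rightarrow> real^'n \<Rightarrow> real^'n" where
  "K \<epsilon> x y = (e (norm (x - y) / \<epsilon>) * J x y) *\<^sub>R (x - y)"

lemma measurable_K [measurable]: "K \<epsilon> x \<in> borel_measurable borel"
  unfolding K_def by measurable

text \<open>Stated for any \<open>c\<close> vanishing below 1, since it serves both \<open>e\<close>
  and t \<open>e'\<close> t.\<close>

lemma cutoff_J_eq_Jtr:
  assumes "norm y \<le> R" "0 < \<epsilon>" and c: "\<And>t. t < 1 \<Longrightarrow> c t = 0"
  shows "c (norm (x - y) / \<epsilon>) * J x y = c (norm (x - y) / \<epsilon>) * Jtr ((1 + R) / \<epsilon>) x y"
proof (cases "norm (x - y) < \<epsilon>")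
  case True
  then show ?thesis using c \<open>0 < \<epsilon>\<close> by simp
next
  case False
  have "0 \<le> R" using assms(1) norm_ge_zero[of y] by linarith
  then have "1 + R \<le> (1 + R) / \<epsilon> * norm (x - y)"
    using False \<open>0 < \<epsilon>\<close> by (simp add: pos_le_divide_eq mult_left_mono)
  then show ?thesis
    using J_eq_Jtr[OF assms(1), of "(1 + R) / \<epsilon>" x] \<open>0 < \<epsilon>\<close> \<open>0 \<le> R\<close> by simp
qed

context
  fixes R \<epsilon> :: real
  assumes R: "0 \<le> R" and \<epsilon>: "0 < \<epsilon>"
begin

text \<open>The scalar factor of \<open>K\<close> with \<open>J\<close> truncated. It is the same
  factor for \<open>norm y \<le> R\<close>, but differentiable in x for all x and y.\<close>

definition coeff_K :: "real^'n \<Rightarrow> real^'n \<Rightarrow> real" where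
  "coeff_K x y = e (norm (x - y) / \<epsilon>) * Jtr ((1 + R) / \<epsilon>) x y"

definition coeff_K' :: "real^'n \<Rightarrow> real^'n \<Rightarrow> real^'n \<Rightarrow> real" where
  "coeff_K' x y h = e (norm (x - y) / \<epsilon>) * Jtr_deriv ((1 + R) / \<epsilon>) x y h
     + e' (norm (x - y) / \<epsilon>) * (((x - y) \<bullet> h) / (norm (x - y) * \<epsilon>)) * Jtr ((1 + R) / \<epsilon>) x y"

lemma K_eq: "norm y \<le> R \<Longrightarrow> K \<epsilon> x y = coeff_K x y *\<^sub>R (x - y)"
  using cutoff_J_eq_Jtr[of y R \<epsilon> e x] \<epsilon> eq_0 by (simp add: K_def coeff_K_def)

lemma coeff_K_has_derivative: "((\<lambda>x. coeff_K x y) has_derivative coeff_K' x y) (at x)"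
proof -
  have "((\<lambda>x. x - y) has_derivative (\<lambda>h. h)) (at x)"
    by (auto intro!: derivative_eq_intros)
  from has_derivative_compose[OF this e_norm_has_derivative[OF \<epsilon>, of "x - y"]]
  have "((\<lambda>x. e (norm (x - y) / \<epsilon>)) has_derivative
      (\<lambda>h. e' (norm (x - y) / \<epsilon>) * (((x - y) \<bullet> h) / (norm (x - y) * \<epsilon>)))) (at x)" .
  from has_derivative_mult[OF this Jtr_has_derivative]
  show ?thesis unfolding coeff_K_def coeff_K'_def[abs_def] .
qed

lemma coeff_K_bound: "\<bar>coeff_K x y\<bar> \<le> 2 * (B * ((1 + R) / \<epsilon>) ^ CARD('n))"
  unfolding coeff_K_def using R \<epsilon> by (intro abs_mult_le e_bound Jtr_bound) auto

text \<open>Both factors are bounded and Lipschitz in x; the cutoff has slope at most 2 /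
  eps.\<close>

lemma coeff_K_lipschitz:
  "\<bar>coeff_K x' y - coeff_K x y\<bar> \<le> (2 / \<epsilon> * (B * ((1 + R) / \<epsilon>) ^ CARD('n)) + 2 * (L * ((1 + R) / \<epsilon>) ^ Suc CARD('n))) * norm (x' - x)"
proof -
  let ?A = "(1 + R) / \<epsilon>"
  have A: "0 \<le> ?A" using R \<epsilon> by simp
  have "\<bar>e (norm (x' - y) / \<epsilon>) - e (norm (x - y) / \<epsilon>)\<bar> \<le> 2 * \<bar>norm (x' - y) / \<epsilon> - norm (x - y) / \<epsilon>\<bar>"
    by (rule e_lipschitz)
  also have "\<dots> \<le> 2 / \<epsilon> * norm (x' - x)"
    using norm_triangle_ineq3[of "x' - y" "x - y"] \<epsilon> by (simp add: divide_right_mono flip: diff_divide_distrib)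
  finally have 1: "\<bar>e (norm (x' - y) / \<epsilon>) - e (norm (x - y) / \<epsilon>)\<bar> \<le> 2 / \<epsilon> * norm (x' - x)" .
  have "coeff_K x' y - coeff_K x y = (e (norm (x' - y) / \<epsilon>) - e (norm (x - y) / \<epsilon>)) * Jtr ?A x' y
     + e (norm (x - y) / \<epsilon>) * (Jtr ?A x' y - Jtr ?A x y)"
    by (simp add: coeff_K_def algebra_simps)
  also have "\<bar>\<dots>\<bar> \<le> (2 / \<epsilon> * norm (x' - x)) * (B * ?A ^ CARD('n)) + 2 * (L * ?A ^ Suc CARD('n) * norm (x' - x))"
    by (intro order_trans[OF abs_triangle_ineq] add_mono abs_mult_le 1 Jtr_bound[OF A] Jtr_lipschitz[OF A] e_bound)
  finally show ?thesis by (simp add: algebra_simps)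
qed

text \<open>A single constant, uniform in y, so that a multiple of the indicator of
  \<open>cball 0 R\<close> can serve as majorant for differentiation under the integral.\<close>

lemma coeff_K_vector_lipschitz:
  obtains M where "0 \<le> M" "\<And>x' y. norm (x' - x) < 1 \<Longrightarrow> norm y \<le> R \<Longrightarrow> norm (coeff_K x' y *\<^sub>R (x' - y)) \<le> M"
    "\<And>x' y. norm (x' - x) < 1 \<Longrightarrow> norm y \<le> R \<Longrightarrow>
       norm (coeff_K x' y *\<^sub>R (x' - y) - coeff_K x y *\<^sub>R (x - y)) \<le> M * norm (x' - x)"
proof -
  define b where "b = 2 * (B * ((1 + R) / \<epsilon>) ^ CARD('n))"
  define l where "l = 2 / \<epsilon> * (B * ((1 + R) / \<epsilon>) ^ CARD('n)) + 2 * (L * ((1 + R) / \<epsilon>) ^ Suc CARD('n))"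
  define U where "U = norm x + 1 + R"
  have b: "0 \<le> b" and l: "0 \<le> l" and U: "0 \<le> U"
    using R \<epsilon> B_nonneg L_nonneg by (auto simp: b_def l_def U_def)
  have nU: "norm (x' - y) \<le> U" if "norm (x' - x) < 1" "norm y \<le> R" for x' y
    using that norm_triangle_ineq4[of x' y] norm_triangle_sub[of x' x] by (simp add: U_def)
  show thesis
  proof (rule that[of "b * U + (l * U + b)"])
    show "0 \<le> b * U + (l * U + b)" using b l U by auto
    fix x' y :: "real^'n" assume *: "norm (x' - x) < 1" "norm y \<le> R"
    have "norm (coeff_K x' y *\<^sub>R (x' - y)) \<le> b * U"
      using coeff_K_bound[of x' y] nU[OF *] b by (auto simp: b_def intro!: mult_mono)
    then show "norm (coeff_K x' y *\<^sub>R (x' - y)) \<le> b * U + (l * U + b)"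
      using b l U by (simp add: add_increasing2)
    have "coeff_K x' y *\<^sub>R (x' - y) - coeff_K x y *\<^sub>R (x - y) = (coeff_K x' y - coeff_K x y) *\<^sub>R (x' - y) + coeff_K x y *\<^sub>R (x' - x)"
      by (simp add: algebra_simps)
    also have "norm \<dots> \<le> l * norm (x' - x) * U + b * norm (x' - x)"
      using coeff_K_lipschitz[of x' y x] coeff_K_bound[of x y] nU[OF *] l b
      by (intro order_trans[OF norm_triangle_ineq] add_mono)
         (auto simp: b_def l_def simp del: times_divide_eq_left times_divide_eq_right intro!: mult_mono)
    also have "\<dots> = (l * U + b) * norm (x' - x)" by (simp add: algebra_simps)
    also have "\<dots> \<le> (b * U + (l * U + b)) * norm (x' - x)"
      using b l U by (intro mult_right_mono) auto
    finally show "norm (coeff_K x' y *\<^sub>R (x' - y) - coeff_K x y *\<^sub>R (x - y)) \<le> (b * U + (l * U + b)) * norm (x' - x)" .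
  qed
qed

text \<open>The derivative of \<open>coeff_K x y *\<^sub>R (x - y)\<close> is a multiple of the
  identity plus a rank-one map, so its trace is n \<open>coeff_K\<close> plus
  \<open>coeff_K'\<close> in the direction x - y. The part with \<open>e\<close> is then
  \<open>Jtr_radial_identity\<close>, whose condition on the level is met because eps <= 1.\<close>

lemma coeff_K_trace:
  assumes "norm y \<le> R" "\<epsilon> \<le> 1"
  shows "(\<Sum>i\<in>UNIV. (coeff_K x y *\<^sub>R axis i 1 + coeff_K' x y (axis i 1) *\<^sub>R (x - y)) $ i)
    = - (\<psi> x * e (norm (x - y) / \<epsilon>)) + e' (norm (x - y) / \<epsilon>) * (norm (x - y) / \<epsilon>) * J x y"
proof -
  let ?A = "(1 + R) / \<epsilon>"
  have A: "1 \<le> ?A" using R \<epsilon> assms by simp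
  have "(\<Sum>i\<in>UNIV. (coeff_K x y *\<^sub>R axis i 1 + coeff_K' x y (axis i 1) *\<^sub>R (x - y)) $ i)
    = (\<Sum>i\<in>(UNIV::'n set). coeff_K x y) + (\<Sum>i\<in>UNIV. coeff_K' x y (axis i 1) * (x - y) $ i)"
    by (simp only: sum.distrib vector_add_component vector_scaleR_component axis_nth) simp
  also have "\<dots> = real CARD('n) * coeff_K x y + coeff_K' x y (x - y)"
    by (subst linear_sum_axis[OF has_derivative_linear[OF coeff_K_has_derivative]]) simp
  \<comment> \<open>In the direction x - y the derivative of the cutoff has the factor |x - y|^2 /
    (|x - y| eps) = |x - y| / eps; for x = y both are 0.\<close>
  also have "\<dots> = e (norm (x - y) / \<epsilon>) * (real CARD('n) * Jtr ?A x y + Jtr_deriv ?A x y (x - y))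
     + e' (norm (x - y) / \<epsilon>) * (norm (x - y) / \<epsilon>) * Jtr ?A x y"
    by (cases "x = y") (auto simp: coeff_K_def coeff_K'_def algebra_simps dot_square_norm power2_eq_square)
  also have "e (norm (x - y) / \<epsilon>) * (real CARD('n) * Jtr ?A x y + Jtr_deriv ?A x y (x - y)) = - (\<psi> x * e (norm (x - y) / \<epsilon>))"
  proof (cases "norm (x - y) < \<epsilon>")
    case True
    then show ?thesis using eq_0[of "norm (x - y) / \<epsilon>"] \<epsilon> by simp
  next
    case False
    then have "1 + R \<le> ?A * norm (x - y)"
      using R \<epsilon> by (simp add: pos_le_divide_eq mult_left_mono)
    from Jtr_radial_identity[OF assms(1) this A] show ?thesis by simp
  qed
  also have "e' (norm (x - y) / \<epsilon>) * (norm (x - y) / \<epsilon>) * Jtr ?A x y = e' (norm (x - y) / \<epsilon>) * (norm (x - y) / \<epsilon>) * J x y"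
    using cutoff_J_eq_Jtr[of y R \<epsilon> "\<lambda>t. e' t * t" x] \<epsilon> assms(1) deriv_eq_0 by auto
  finally show ?thesis .
qed

end

lemma divergence_regularized:
  fixes f :: "real^'n \<Rightarrow> real"
  assumes f [measurable]: "f \<in> borel_measurable borel" and f_bound: "\<And>y. \<bar>f y\<bar> \<le> C"
    and f_supp: "\<And>y. R < norm y \<Longrightarrow> f y = 0" and "0 \<le> R" "0 < \<epsilon>" "\<epsilon> \<le> 1"
  shows "divergence (\<lambda>x. \<integral>y. f y *\<^sub>R K \<epsilon> x y \<partial>lborel) x =
        - (\<psi> x * (\<integral>y. f y * e (norm (x - y) / \<epsilon>) \<partial>lborel))
        + (\<integral>y. f y * (e' (norm (x - y) / \<epsilon>) * (norm (x - y) / \<epsilon>) * J x y) \<partial>lborel)"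
proof -
  note cc = \<open>0 \<le> R\<close> \<open>0 < \<epsilon>\<close>
  have C: "0 \<le> C" using f_bound[of 0] by linarith
  obtain M where M: "0 \<le> M" "\<And>x' y. norm (x' - x) < 1 \<Longrightarrow> norm y \<le> R \<Longrightarrow> norm (coeff_K R \<epsilon> x' y *\<^sub>R (x' - y)) \<le> M"
    "\<And>x' y. norm (x' - x) < 1 \<Longrightarrow> norm y \<le> R \<Longrightarrow>
       norm (coeff_K R \<epsilon> x' y *\<^sub>R (x' - y) - coeff_K R \<epsilon> x y *\<^sub>R (x - y)) \<le> M * norm (x' - x)"
    using coeff_K_vector_lipschitz[OF cc] by metis
  define D where "D y h = f y *\<^sub>R (coeff_K R \<epsilon> x y *\<^sub>R h + coeff_K' R \<epsilon> x y h *\<^sub>R (x - y))" for y h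
  \<comment> \<open>Valid for every y: where the truncation may be inexact, \<open>f\<close>
    vanishes.\<close>
  have fK: "f y *\<^sub>R K \<epsilon> x' y = f y *\<^sub>R (coeff_K R \<epsilon> x' y *\<^sub>R (x' - y))" for x' y
    using K_eq[OF cc] f_supp by (cases "norm y \<le> R") auto
  have g: "integrable lborel (\<lambda>y::real^'n. C * M * indicator (cball 0 R) y)"
    by (intro integrable_mult_right integrable_indicator_cball)
  have bnd: "norm (f y *\<^sub>R u) \<le> (C * M * indicator (cball 0 R) y) * t" if "norm y \<le> R \<Longrightarrow> norm u \<le> M * t" "0 \<le> t" for y u t
  proof (cases "norm y \<le> R")
    case True
    then have "norm (f y *\<^sub>R u) \<le> C * (M * t)"
      unfolding norm_scaleR using that f_bound[of y] C M(1) by (intro mult_mono) auto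
    then show ?thesis using True by simp
  qed (use f_supp that in auto)
  have "integrable lborel (\<lambda>y. f y *\<^sub>R K \<epsilon> x' y)" if "norm (x' - x) < 1" for x'
  proof (rule Bochner_Integration.integrable_bound[OF g])
    have "norm (f y *\<^sub>R K \<epsilon> x' y) \<le> (C * M * indicator (cball 0 R) y) * 1" for y
      unfolding fK using M(2)[OF that] by (intro bnd) auto
    then show "AE y in lborel. norm (f y *\<^sub>R K \<epsilon> x' y) \<le> norm (C * M * indicator (cball 0 R) y)"
      by (auto intro!: order_trans[OF _ abs_ge_self])
  qed measurable
  note deriv = has_derivative_integral_dominated[where \<delta> = 1 and x = x and M = lborel and f = "\<lambda>x y. f y *\<^sub>R K \<epsilon> x y" and f' = D, OF zero_less_one this _ _ g]
    integrable_derivative_dominated[where \<delta> = 1 and x = x and M = lborel and f = "\<lambda>x y. f y *\<^sub>R K \<epsilon> x y" and f' = D, OF zero_less_one this _ _ g]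
  have 1: "((\<lambda>x. f y *\<^sub>R K \<epsilon> x y) has_derivative D y) (at x)" for y
    unfolding fK D_def[abs_def]
    by (rule has_derivative_scaleR_right, rule has_derivative_eq_rhs[OF has_derivative_scaleR[OF coeff_K_has_derivative[OF cc]]])
       (auto intro!: derivative_eq_intros)
  have 2: "norm (f y *\<^sub>R K \<epsilon> x' y - f y *\<^sub>R K \<epsilon> x y) \<le> (C * M * indicator (cball 0 R) y) * norm (x' - x)" if "norm (x' - x) < 1" for x' y
    using bnd[of y "coeff_K R \<epsilon> x' y *\<^sub>R (x' - y) - coeff_K R \<epsilon> x y *\<^sub>R (x - y)" "norm (x' - x)"] M(3)[OF that]
    by (simp add: fK scaleR_diff_right)
  have Dint: "integrable lborel (\<lambda>y. D y h)" for h
    using deriv(2)[OF _ 1 2] by auto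
  have "divergence (\<lambda>x. \<integral>y. f y *\<^sub>R K \<epsilon> x y \<partial>lborel) x = (\<Sum>i\<in>UNIV. (\<integral>y. D y (axis i 1) \<partial>lborel) $ i)"
    using deriv(1)[OF _ 1 2] by (intro divergence_eq) auto
  also have "\<dots> = (\<Sum>i\<in>UNIV. (\<integral>y. D y (axis i 1) $ i \<partial>lborel))"
    by (intro sum.cong refl integral_bounded_linear[OF bounded_linear_vec_nth Dint, symmetric])
  also have "\<dots> = (\<integral>y. (\<Sum>i\<in>UNIV. D y (axis i 1) $ i) \<partial>lborel)"
    by (intro Bochner_Integration.integral_sum[symmetric] integrable_bounded_linear[OF bounded_linear_vec_nth Dint])
  finally have div: "divergence (\<lambda>x. \<integral>y. f y *\<^sub>R K \<epsilon> x y \<partial>lborel) x = (\<integral>y. (\<Sum>i\<in>UNIV. D y (axis i 1) $ i) \<partial>lborel)" .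
  have tr: "(\<Sum>i\<in>UNIV. D y (axis i 1) $ i) = - \<psi> x * (f y * e (norm (x - y) / \<epsilon>))
     + f y * (e' (norm (x - y) / \<epsilon>) * (norm (x - y) / \<epsilon>) * J x y)" for y
  proof (cases "norm y \<le> R")
    case True
    have "(\<Sum>i\<in>UNIV. D y (axis i 1) $ i) = f y * (\<Sum>i\<in>UNIV. (coeff_K R \<epsilon> x y *\<^sub>R axis i 1 + coeff_K' R \<epsilon> x y (axis i 1) *\<^sub>R (x - y)) $ i)"
      by (simp only: D_def vector_scaleR_component sum_distrib_left real_scaleR_def)
    also have "\<dots> = f y * (- (\<psi> x * e (norm (x - y) / \<epsilon>)) + e' (norm (x - y) / \<epsilon>) * (norm (x - y) / \<epsilon>) * J x y)"
      by (subst coeff_K_trace[OF cc True \<open>\<epsilon> \<le> 1\<close>]) simp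
    finally show ?thesis by (simp only: distrib_left mult_minus_left mult_minus_right mult_ac)
  qed (use f_supp in \<open>auto simp: D_def\<close>)
  have e_int: "integrable lborel (\<lambda>y. f y * e (norm (x - y) / \<epsilon>))"
  proof (rule Bochner_Integration.integrable_bound)
    show "integrable lborel (\<lambda>y::real^'n. C * 2 * indicator (cball 0 R) y)"
      by (intro integrable_mult_right integrable_indicator_cball)
    show "AE y in lborel. norm (f y * e (norm (x - y) / \<epsilon>)) \<le> norm (C * 2 * indicator (cball 0 R) y)"
    proof (rule AE_I2)
      fix y
      show "norm (f y * e (norm (x - y) / \<epsilon>)) \<le> norm (C * 2 * indicator (cball 0 R) y)"
        using f_bound[of y] e_bound[of "norm (x - y) / \<epsilon>"] f_supp[of y] C
        by (cases "norm y \<le> R") (auto simp: abs_mult intro!: mult_mono)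
    qed
  qed measurable
  have sum_int: "integrable lborel (\<lambda>y. - \<psi> x * (f y * e (norm (x - y) / \<epsilon>))
     + f y * (e' (norm (x - y) / \<epsilon>) * (norm (x - y) / \<epsilon>) * J x y))"
    unfolding tr[symmetric]
    by (intro Bochner_Integration.integrable_sum integrable_bounded_linear[OF bounded_linear_vec_nth Dint])
  \<comment> \<open>The second summand is integrable as a difference: the whole sum is the trace of
    the integrable \<open>D\<close>, and the first summand is bounded with bounded support.\<close>
  from Bochner_Integration.integrable_diff[OF this integrable_mult_right[OF e_int, of "- \<psi> x"]]
  have int: "integrable lborel (\<lambda>y. f y * (e' (norm (x - y) / \<epsilon>) * (norm (x - y) / \<epsilon>) * J x y))"
    by simp
  show "divergence (\<lambda>x. \<integral>y. f y *\<^sub>R K \<epsilon> x y \<partial>lborel) x =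
        - (\<psi> x * (\<integral>y. f y * e (norm (x - y) / \<epsilon>) \<partial>lborel))
        + (\<integral>y. f y * (e' (norm (x - y) / \<epsilon>) * (norm (x - y) / \<epsilon>) * J x y) \<partial>lborel)"
    unfolding div tr using e_int int by (subst Bochner_Integration.integral_add) auto
qed

subsection \<open>The limit of the divergence\<close>

text \<open>The rescaled J, see \<open>J_rescaled\<close>. Unlike J it makes sense at eps = 0, where
  it is the integral of \<open>\<psi>\<close> along a ray from x with weight s^(n-1).\<close>

definition P :: "real^'n \<Rightarrow> real \<Rightarrow> real^'n \<Rightarrow> real" where
  "P x \<epsilon> z = (LINT s:{0..}|lborel. \<psi> (x + s *\<^sub>R z) * (\<epsilon> + s) ^ (CARD('n) - 1))"

lemma measurable_P [measurable]: "P x \<epsilon> \<in> borel_measurable borel"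
  unfolding P_def[abs_def] set_lebesgue_integral_def
  by (rule lborel.borel_measurable_lebesgue_integral) (simp add: split_beta')

text \<open>The substitution alpha = 1 + s / eps costs one factor eps; the other n - 1 turn (1 + s /
  eps)^(n-1) into (eps + s)^(n-1).\<close>

lemma J_rescaled:
  assumes "0 < \<epsilon>"
  shows "\<epsilon> ^ CARD('n) * J x (x - \<epsilon> *\<^sub>R z) = P x \<epsilon> z"
proof -
  have J: "J x (x - \<epsilon> *\<^sub>R z) = \<bar>1 / \<epsilon>\<bar> *\<^sub>R (\<integral>s. indicator {1..} (1 + 1 / \<epsilon> * s) *\<^sub>R
      (\<psi> (x - \<epsilon> *\<^sub>R z + (1 + 1 / \<epsilon> * s) *\<^sub>R (x - (x - \<epsilon> *\<^sub>R z))) * (1 + 1 / \<epsilon> * s) ^ (CARD('n) - 1)) \<partial>lborel)"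
    unfolding J_def set_lebesgue_integral_def using assms by (intro lborel_integral_real_affine) auto
  have "\<epsilon> ^ CARD('n) * J x (x - \<epsilon> *\<^sub>R z) = (\<integral>s. \<epsilon> ^ (CARD('n) - 1) * (indicator {1..} (1 + 1 / \<epsilon> * s) *\<^sub>R
      (\<psi> (x - \<epsilon> *\<^sub>R z + (1 + 1 / \<epsilon> * s) *\<^sub>R (x - (x - \<epsilon> *\<^sub>R z))) * (1 + 1 / \<epsilon> * s) ^ (CARD('n) - 1))) \<partial>lborel)"
    unfolding J using assms by (simp add: power_card_eq)
  also have "\<dots> = P x \<epsilon> z"
    unfolding P_def set_lebesgue_integral_def
  proof (rule Bochner_Integration.integral_cong[OF refl])
    fix s :: real
    have 1: "\<epsilon> ^ (CARD('n) - 1) * (1 + 1 / \<epsilon> * s) ^ (CARD('n) - 1) = (\<epsilon> + s) ^ (CARD('n) - 1)"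
      using assms by (simp add: power_mult_distrib[symmetric] distrib_left)
    have 2: "x - \<epsilon> *\<^sub>R z + (1 + 1 / \<epsilon> * s) *\<^sub>R (x - (x - \<epsilon> *\<^sub>R z)) = x + s *\<^sub>R z"
      using assms by (simp add: scaleR_add_left distrib_right)
    have 3: "indicator {1..} (1 + 1 / \<epsilon> * s) = (indicator {0..} s :: real)"
      using assms by (simp add: indicator_def zero_le_divide_iff)
    show "\<epsilon> ^ (CARD('n) - 1) * (indicator {1..} (1 + 1 / \<epsilon> * s) *\<^sub>R
        (\<psi> (x - \<epsilon> *\<^sub>R z + (1 + 1 / \<epsilon> * s) *\<^sub>R (x - (x - \<epsilon> *\<^sub>R z))) * (1 + 1 / \<epsilon> * s) ^ (CARD('n) - 1)))
      = indicator {0..} s *\<^sub>R (\<psi> (x + s *\<^sub>R z) * (\<epsilon> + s) ^ (CARD('n) - 1))"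
      unfolding 2 3 1[symmetric] by (simp add: mult_ac)
  qed
  finally show ?thesis .
qed

text \<open>Only |z| >= 1 matters, as \<open>e'\<close> vanishes below 1; then |x + s z| >= s - |x|
  > 1 for s > 1 + |x|.\<close>

lemma P_truncate:
  assumes "1 \<le> norm z"
  shows "P x \<epsilon> z = (LINT s:{0..1 + norm x}|lborel. \<psi> (x + s *\<^sub>R z) * (\<epsilon> + s) ^ (CARD('n) - 1))"
  unfolding P_def set_lebesgue_integral_def
proof (rule Bochner_Integration.integral_cong[OF refl])
  fix s :: real
  have "\<psi> (x + s *\<^sub>R z) = 0" if "1 + norm x < s"
  proof (rule zero_outside)
    have "1 + norm x < s * norm z"
      using that assms norm_ge_zero[of x] mult_left_mono[of 1 "norm z" s] by linarith
    then show "1 \<le> norm (x + s *\<^sub>R z)"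
      using norm_triangle_ineq2[of "s *\<^sub>R z" "- x"] that norm_ge_zero[of x] by (simp add: add.commute)
  qed
  then show "indicator {0..} s *\<^sub>R (\<psi> (x + s *\<^sub>R z) * (\<epsilon> + s) ^ (CARD('n) - 1)) =
      indicator {0..1 + norm x} s *\<^sub>R (\<psi> (x + s *\<^sub>R z) * (\<epsilon> + s) ^ (CARD('n) - 1))"
    by (auto simp: indicator_def)
qed

text \<open>On the interval eps + s <= 1 + (1 + |x|), whatever eps and z are.\<close>

lemma P_integrand_bound:
  assumes "0 \<le> \<epsilon>" "\<epsilon> \<le> 1"
  shows "norm (indicator {0..1 + norm x} s *\<^sub>R (\<psi> (x + s *\<^sub>R z) * (\<epsilon> + s) ^ (CARD('n) - 1)))
     \<le> B * (2 + norm x) ^ (CARD('n) - 1) * indicator {0..1 + norm x} s"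
proof -
  have "\<bar>\<psi> (x + s *\<^sub>R z) * (\<epsilon> + s) ^ (CARD('n) - 1)\<bar> \<le> B * (2 + norm x) ^ (CARD('n) - 1)" if "0 \<le> s" "s \<le> 1 + norm x"
    using that assms by (intro abs_mult_le bound) (simp add: power_abs power_mono)
  then show ?thesis by (auto simp: indicator_def)
qed

lemma P_bound:
  assumes "1 \<le> norm z" "0 \<le> \<epsilon>" "\<epsilon> \<le> 1"
  shows "\<bar>P x \<epsilon> z\<bar> \<le> B * (2 + norm x) ^ (CARD('n) - 1) * (1 + norm x)"
proof -
  have "norm (P x \<epsilon> z) \<le> (\<integral>s. B * (2 + norm x) ^ (CARD('n) - 1) * indicator {0..1 + norm x} s \<partial>lborel)"
    unfolding P_truncate[OF assms(1)] set_lebesgue_integral_def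
    by (rule norm_lebesgue_integral_le[OF integrable_const_Icc P_integrand_bound[OF assms(2,3)]])
  then show ?thesis by simp
qed

lemma P_tendsto:
  assumes "1 \<le> norm z"
  shows "((\<lambda>\<epsilon>. P x \<epsilon> z) \<longlongrightarrow> P x 0 z) (at_right 0)"
  unfolding P_truncate[OF assms] set_lebesgue_integral_def
proof (rule integral_dominated_convergence_at_right[where c = 1 and w = "\<lambda>s. B * (2 + norm x) ^ (CARD('n) - 1) * indicator {0..1 + norm x} s"])
  show "AE s in lborel. ((\<lambda>\<epsilon>. indicator {0..1 + norm x} s *\<^sub>R (\<psi> (x + s *\<^sub>R z) * (\<epsilon> + s) ^ (CARD('n) - 1))) \<longlongrightarrow>
      indicator {0..1 + norm x} s *\<^sub>R (\<psi> (x + s *\<^sub>R z) * (0 + s) ^ (CARD('n) - 1))) (at_right 0)"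
    by (intro AE_I2 tendsto_intros)
  show "norm (indicator {0..1 + norm x} s *\<^sub>R (\<psi> (x + s *\<^sub>R z) * (\<epsilon> + s) ^ (CARD('n) - 1)))
     \<le> B * (2 + norm x) ^ (CARD('n) - 1) * indicator {0..1 + norm x} s" if "0 < \<epsilon>" "\<epsilon> < 1" for \<epsilon> s
    using that by (intro P_integrand_bound) auto
qed (simp_all only: zero_less_one integrable_const_Icc, measurable)

text \<open>Rescaling turns the shrinking shell into the fixed shell 1 <= |z| <= 2, so dominated
  convergence applies.\<close>

lemma concentrated_term_tendsto:
  fixes f :: "real^'n \<Rightarrow> real"
  assumes f [measurable]: "f \<in> borel_measurable borel" and f_bound: "\<And>y. \<bar>f y\<bar> \<le> C"
    and f_cont: "isCont f x"
  shows "((\<lambda>\<epsilon>. \<integral>y. f y * (e' (norm (x - y) / \<epsilon>) * (norm (x - y) / \<epsilon>) * J x y) \<partial>lborel) \<longlongrightarrow>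
     f x * (\<integral>z. e' (norm z) * norm z * P x 0 z \<partial>lborel)) (at_right 0)"
proof -
  \<comment> \<open>In order: the bounds for \<open>f\<close>, for \<open>e'\<close>, for |z| on the
    shell, and \<open>P_bound\<close>.\<close>
  let ?b = "C * (2 * 2 * (B * (2 + norm x) ^ (CARD('n) - 1) * (1 + norm x)))"
  have C: "0 \<le> C" using f_bound[of 0] by linarith
  have resc: "(\<integral>y. f y * (e' (norm (x - y) / \<epsilon>) * (norm (x - y) / \<epsilon>) * J x y) \<partial>lborel)
     = (\<integral>z. f (x - \<epsilon> *\<^sub>R z) * (e' (norm z) * norm z * P x \<epsilon> z) \<partial>lborel)" if "0 < \<epsilon>" for \<epsilon>
  proof -
    have "(\<integral>y. f y * (e' (norm (x - y) / \<epsilon>) * (norm (x - y) / \<epsilon>) * J x y) \<partial>lborel)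
      = \<bar>- \<epsilon>\<bar> ^ DIM(real^'n) * (\<integral>z. f (x + (- \<epsilon>) *\<^sub>R z) * (e' (norm (x - (x + (- \<epsilon>) *\<^sub>R z)) / \<epsilon>)
         * (norm (x - (x + (- \<epsilon>) *\<^sub>R z)) / \<epsilon>) * J x (x + (- \<epsilon>) *\<^sub>R z)) \<partial>lborel)"
      using that by (intro lebesgue_integral_affine) auto
    also have "\<dots> = (\<integral>z. f (x - \<epsilon> *\<^sub>R z) * (e' (norm z) * norm z * (\<epsilon> ^ CARD('n) * J x (x - \<epsilon> *\<^sub>R z))) \<partial>lborel)"
      using that by (subst integral_mult_right_zero[symmetric]) (simp add: mult_ac)
    finally show ?thesis using that by (simp add: J_rescaled)
  qed
  have "((\<lambda>\<epsilon>. \<integral>z. f (x - \<epsilon> *\<^sub>R z) * (e' (norm z) * norm z * P x \<epsilon> z) \<partial>lborel) \<longlongrightarrow>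
     (\<integral>z. f x * (e' (norm z) * norm z * P x 0 z) \<partial>lborel)) (at_right 0)"
  proof (rule integral_dominated_convergence_at_right[where c = 1 and w = "\<lambda>z. ?b * indicator (cball 0 2) z"])
    show "AE z in lborel. ((\<lambda>\<epsilon>. f (x - \<epsilon> *\<^sub>R z) * (e' (norm z) * norm z * P x \<epsilon> z)) \<longlongrightarrow>
       f x * (e' (norm z) * norm z * P x 0 z)) (at_right 0)"
    proof (rule AE_I2)
      fix z :: "real^'n"
      show "((\<lambda>\<epsilon>. f (x - \<epsilon> *\<^sub>R z) * (e' (norm z) * norm z * P x \<epsilon> z)) \<longlongrightarrow>
         f x * (e' (norm z) * norm z * P x 0 z)) (at_right 0)"
      proof (cases "1 \<le> norm z")
        case True
        have "((\<lambda>\<epsilon>. x - \<epsilon> *\<^sub>R z) \<longlongrightarrow> x - 0 *\<^sub>R z) (at_right 0)"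
          by (intro tendsto_intros ident_at_right_0)
        then have "((\<lambda>\<epsilon>. f (x - \<epsilon> *\<^sub>R z)) \<longlongrightarrow> f x) (at_right 0)"
          using isCont_tendsto_compose[OF f_cont] by simp
        then show ?thesis by (intro tendsto_intros P_tendsto True)
      next
        case False
        then show ?thesis using deriv_eq_0[of "norm z"] by simp
      qed
    qed
    show "norm (f (x - \<epsilon> *\<^sub>R z) * (e' (norm z) * norm z * P x \<epsilon> z)) \<le> ?b * indicator (cball 0 2) z"
      if "0 < \<epsilon>" "\<epsilon> < 1" for \<epsilon> z
    proof (cases "1 \<le> norm z \<and> norm z \<le> 2")
      case True
      then have "\<bar>f (x - \<epsilon> *\<^sub>R z) * (e' (norm z) * norm z * P x \<epsilon> z)\<bar> \<le> ?b"
        using that by (intro abs_mult_le f_bound deriv_bound P_bound) auto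
      then show ?thesis using True by simp
    next
      case False
      then have "e' (norm z) = 0" by (intro deriv_eq_0) auto
      then show ?thesis using C B_nonneg by simp
    qed
    show "integrable lborel (\<lambda>z::real^'n. ?b * indicator (cball 0 2) z)"
      by (intro integrable_mult_right integrable_indicator_cball)
  qed measurable
  then have "((\<lambda>\<epsilon>. \<integral>z. f (x - \<epsilon> *\<^sub>R z) * (e' (norm z) * norm z * P x \<epsilon> z) \<partial>lborel) \<longlongrightarrow>
     f x * (\<integral>z. e' (norm z) * norm z * P x 0 z \<partial>lborel)) (at_right 0)"
    by simp
  then show ?thesis
    by (rule Lim_transform_eventually)
       (use resc in \<open>auto simp: eventually_at intro!: exI[of _ 1]\<close>)
qed

text \<open>For y different from x the cutoff equals 1 as soon as 2 eps <= |x - y|.\<close>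

lemma bulk_term_tendsto:
  fixes f :: "real^'n \<Rightarrow> real"
  assumes f: "integrable lborel f"
  shows "((\<lambda>\<epsilon>. \<integral>y. f y * e (norm (x - y) / \<epsilon>) \<partial>lborel) \<longlongrightarrow> (\<integral>y. f y \<partial>lborel)) (at_right 0)"
proof (rule integral_dominated_convergence_at_right[where c = 1 and w = "\<lambda>y. 2 * \<bar>f y\<bar>"])
  have [measurable]: "f \<in> borel_measurable borel" using f by auto
  show "(\<lambda>y. f y * e (norm (x - y) / \<epsilon>)) \<in> borel_measurable lborel" for \<epsilon> by measurable
  have "AE y in lborel. y \<noteq> x" by (rule AE_lborel_singleton)
  then show "AE y in lborel. ((\<lambda>\<epsilon>. f y * e (norm (x - y) / \<epsilon>)) \<longlongrightarrow> f y) (at_right 0)"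
  proof eventually_elim
    fix y assume "y \<noteq> x"
    then have "\<forall>\<^sub>F \<epsilon> in at_right 0. f y = f y * e (norm (x - y) / \<epsilon>)"
      by (auto simp: eventually_at dist_real_def pos_le_divide_eq intro!: exI[of _ "norm (x - y) / 2"] eq_1)
    then show "((\<lambda>\<epsilon>. f y * e (norm (x - y) / \<epsilon>)) \<longlongrightarrow> f y) (at_right 0)"
      by (rule Lim_transform_eventually[OF tendsto_const])
  qed
  show "norm (f y * e (norm (x - y) / \<epsilon>)) \<le> 2 * \<bar>f y\<bar>" for \<epsilon> y
    using abs_mult_le[OF order_refl e_bound, of "f y" "norm (x - y) / \<epsilon>"] by (simp add: mult.commute)
qed (use f in auto)

section \<open>The average over the fixed shell\<close>

text \<open>Substituting \<open>t = norm w / s\<close> turns the integral into the integral of \<open>e'\<close>.\<close>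

lemma integral_cutoff_scales:
  assumes "w \<noteq> (0::real^'n)" "norm w < S"
  shows "(\<integral>s. indicator {0<..S} s * (e' (norm w / s) * (norm w / s\<^sup>2)) \<partial>lborel) = 1"
proof -
  \<comment> \<open>At s = a the argument of \<open>e\<close> is 2, and below a it exceeds 2, where
    \<open>e'\<close> vanishes. This keeps the interval away from the singularity s = 0.\<close>
  define a where "a = norm w / 2"
  have a: "0 < a" "a \<le> S" using assms norm_ge_zero[of w] unfolding a_def by (simp, linarith)
  have "(\<integral>s. indicator {0<..S} s * (e' (norm w / s) * (norm w / s\<^sup>2)) \<partial>lborel)
    = (\<integral>s. indicator {a..S} s *\<^sub>R (e' (norm w / s) * (norm w / s\<^sup>2)) \<partial>lborel)"
  proof (rule Bochner_Integration.integral_cong[OF refl])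
    fix s :: real
    have "e' (norm w / s) = 0" if "0 < s" "s < a"
      using that by (intro deriv_eq_0) (simp add: a_def pos_less_divide_eq)
    then show "indicator {0<..S} s * (e' (norm w / s) * (norm w / s\<^sup>2)) = indicator {a..S} s *\<^sub>R (e' (norm w / s) * (norm w / s\<^sup>2))"
      using a by (auto simp: indicator_def)
  qed
  also have "\<dots> = - e (norm w / S) - (- e (norm w / a))"
  proof (rule integral_FTC_atLeastAtMost[OF a(2)])
    fix s assume "a \<le> s" "s \<le> S"
    then have "s \<noteq> 0" using a by auto
    then have "((\<lambda>s. norm w / s) has_real_derivative - (norm w / s\<^sup>2)) (at s within {a..S})"
      by (auto intro!: derivative_eq_intros simp: power2_eq_square)
    from DERIV_minus[OF DERIV_chain2[OF has_deriv this]]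
    show "((\<lambda>s. - e (norm w / s)) has_vector_derivative e' (norm w / s) * (norm w / s\<^sup>2)) (at s within {a..S})"
      by (simp add: has_real_derivative_iff_has_vector_derivative[symmetric])
  next
    show "continuous_on {a..S} (\<lambda>s. e' (norm w / s) * (norm w / s\<^sup>2))"
      using a by (intro continuous_intros continuous_on_compose2[OF continuous_deriv]) auto
  qed
  also have "\<dots> = 1"
    using assms eq_0[of "norm w / S"] eq_1[of "norm w / a"] a by (simp add: a_def)
  finally show ?thesis .
qed

text \<open>The integrand lives on |w| / 2 <= s <= |w|, an interval of length |w| / 2, and is at
  most 2 * 4 / |w| there. The product 4 does not depend on w, which is what Fubini needs.\<close>

lemma norm_cutoff_scales_le:
  "(\<integral>s. norm (indicator {0<..S} s * (e' (norm w / s) * (norm w / s\<^sup>2)) :: real) \<partial>lborel) \<le> 4"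
  and integrable_cutoff_scales:
  "integrable lborel (\<lambda>s. indicator {0<..S} s * (e' (norm w / s) * (norm w / s\<^sup>2)) :: real)"
  for w :: "real^'n"
proof -
  let ?w = "\<lambda>s. 8 / norm w * indicator {norm w / 2..norm w} s"
  have bnd: "norm (indicator {0<..S} s * (e' (norm w / s) * (norm w / s\<^sup>2)) :: real) \<le> ?w s" for s
  proof (cases "0 < s \<and> norm w / 2 \<le> s \<and> s \<le> norm w")
    case True
    have "\<bar>norm w / s\<^sup>2\<bar> \<le> 4 / norm w"
    proof -
      have "(norm w / 2)\<^sup>2 \<le> s\<^sup>2" using True by (intro power_mono) auto
      moreover have "0 < norm w" using True by linarith
      ultimately show ?thesis using True by (simp add: field_simps power2_eq_square)
    qed
    then have "\<bar>e' (norm w / s) * (norm w / s\<^sup>2)\<bar> \<le> 2 * (4 / norm w)"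
      by (intro abs_mult_le deriv_bound)
    then show ?thesis using True by (auto simp: indicator_def)
  next
    case False
    have "e' (norm w / s) = 0" if "0 < s"
      using False that by (intro deriv_eq_0) (auto simp: field_simps)
    then show ?thesis by (auto simp: indicator_def)
  qed
  have "(\<integral>s. norm (indicator {0<..S} s * (e' (norm w / s) * (norm w / s\<^sup>2)) :: real) \<partial>lborel) \<le> (\<integral>s. ?w s \<partial>lborel)"
    using bnd by (intro integral_mono'[OF integrable_const_Icc]) auto
  also have "\<dots> \<le> 4" by (simp add: field_simps)
  finally show "(\<integral>s. norm (indicator {0<..S} s * (e' (norm w / s) * (norm w / s\<^sup>2)) :: real) \<partial>lborel) \<le> 4" .
  show "integrable lborel (\<lambda>s. indicator {0<..S} s * (e' (norm w / s) * (norm w / s\<^sup>2)) :: real)"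
  proof (rule Bochner_Integration.integrable_bound[OF integrable_const_Icc])
    show "AE s in lborel. norm (indicator {0<..S} s * (e' (norm w / s) * (norm w / s\<^sup>2)) :: real) \<le> norm (?w s)"
      by (intro AE_I2 order_trans[OF bnd abs_ge_self[THEN order_trans]]) simp
  qed measurable
qed

lemma integrable_psi: "integrable lborel \<psi>"
proof (rule Bochner_Integration.integrable_bound)
  show "integrable lborel (\<lambda>y::real^'n. B * indicator (cball 0 1) y)"
    by (intro integrable_mult_right integrable_indicator_cball)
  show "AE y in lborel. norm (\<psi> y) \<le> norm (B * indicator (cball 0 1) y)"
    using bound zero_outside B_nonneg by (intro AE_I2) (auto simp: indicator_def)
qed simp

lemma integrable_psi_translate: "integrable lborel (\<lambda>w. \<psi> (x + w))"
  and integral_psi_translate: "(\<integral>w. \<psi> (x + w) \<partial>lborel) = (\<integral>w. \<psi> w \<partial>lborel)"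
proof -
  show "(\<integral>w. \<psi> (x + w) \<partial>lborel) = (\<integral>w. \<psi> w \<partial>lborel)"
    using lebesgue_integral_affine[of \<psi> 1 x] by simp
  have "integrable (distr lborel borel ((+) x)) \<psi>"
    using integrable_psi by (simp add: lborel_distr_plus)
  then show "integrable lborel (\<lambda>w. \<psi> (x + w))"
    by (simp add: integrable_distr_eq)
qed

text \<open>Fubini is applied before and after the substitution w = s z, done for fixed s. The
  integrand \<open>g\<close> is continuous on a compact set and zero outside it; \<open>h\<close>
  can be unbounded near w = 0, so its integrability comes from the iterated integral of its norm, at
  most 4 |psi(x + w)|.\<close>

lemma integral_radial_average:
  assumes n2: "2 \<le> CARD('n)"
  shows "(\<integral>z. e' (norm z) * norm z * P x 0 z \<partial>lborel) = (\<integral>w. \<psi> w \<partial>lborel)"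
proof -
  \<comment> \<open>The cut from \<open>P_truncate\<close>; also psi(x + w) = 0 once |w| >=
    S.\<close>
  define S where "S = 1 + norm x"
  define g where "g z s = indicator {0..S} s * (e' (norm z) * norm z * (\<psi> (x + s *\<^sub>R z) * s ^ (CARD('n) - 1)))" for z and s :: real
  define h where "h s w = indicator {0<..S} s * (e' (norm w / s) * (norm w / s\<^sup>2)) * \<psi> (x + w)" for s and w :: "real^'n"
  have g_int: "integrable (lborel \<Otimes>\<^sub>M lborel) (\<lambda>(z, s). g z s)"
  proof -
    have "integrable lborel (\<lambda>p. indicator (cball 0 2 \<times> {0..S}) p *\<^sub>R
        (e' (norm (fst p)) * norm (fst p) * (\<psi> (x + snd p *\<^sub>R fst p) * snd p ^ (CARD('n) - 1))))"
      by (intro borel_integrable_compact compact_Times compact_cball compact_Icc continuous_intros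
           continuous_on_compose2[OF continuous_deriv] continuous_on_compose2[OF continuous[of UNIV]]) auto
    also have "(\<lambda>p. indicator (cball 0 2 \<times> {0..S}) p *\<^sub>R
        (e' (norm (fst p)) * norm (fst p) * (\<psi> (x + snd p *\<^sub>R fst p) * snd p ^ (CARD('n) - 1)))) = (\<lambda>(z, s). g z s)"
      using deriv_eq_0 by (force simp: g_def indicator_def fun_eq_iff not_le)
    finally show ?thesis by (simp add: lborel_prod)
  qed
  have h_meas: "(\<lambda>(w, s). h s w) \<in> borel_measurable (lborel \<Otimes>\<^sub>M lborel)"
    unfolding h_def by measurable
  have h_int: "integrable (lborel \<Otimes>\<^sub>M lborel) (\<lambda>(w, s). h s w)"
  proof (rule lborel_pair.Fubini_integrable[OF h_meas])
    show "AE w in lborel. integrable lborel (\<lambda>s. (\<lambda>(w, s). h s w) (w, s))"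
      unfolding h_def case_prod_conv by (intro AE_I2 integrable_mult_left integrable_cutoff_scales)
    show "integrable lborel (\<lambda>w. \<integral>s. norm ((\<lambda>(w, s). h s w) (w, s)) \<partial>lborel)"
    proof (rule Bochner_Integration.integrable_bound)
      show "integrable lborel (\<lambda>w. 4 * \<psi> (x + w))"
        using integrable_psi_translate by simp
      show "(\<lambda>w. \<integral>s. norm ((\<lambda>(w, s). h s w) (w, s)) \<partial>lborel) \<in> borel_measurable lborel"
        using h_meas by (intro lborel.borel_measurable_lebesgue_integral) (simp add: split_beta')
      show "AE w in lborel. norm (\<integral>s. norm ((\<lambda>(w, s). h s w) (w, s)) \<partial>lborel) \<le> norm (4 * \<psi> (x + w))"
      proof (rule AE_I2)
        fix w :: "real^'n"
        have "(\<integral>s. norm (h s w) \<partial>lborel) = (\<integral>s. norm (indicator {0<..S} s * (e' (norm w / s) * (norm w / s\<^sup>2)) :: real) \<partial>lborel) * \<bar>\<psi> (x + w)\<bar>"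
          unfolding h_def norm_mult[of _ "\<psi> (x + w)"] real_norm_def[of "\<psi> (x + w)"]
          by (rule integral_mult_left_zero)
        also have "\<dots> \<le> 4 * \<bar>\<psi> (x + w)\<bar>"
          by (intro mult_right_mono norm_cutoff_scales_le) simp
        finally show "norm (\<integral>s. norm ((\<lambda>(w, s). h s w) (w, s)) \<partial>lborel) \<le> norm (4 * \<psi> (x + w))"
          by (simp add: abs_mult)
      qed
    qed
  qed
  have gh: "(\<integral>z. g z s \<partial>lborel) = (\<integral>w. h s w \<partial>lborel)" for s
  proof (cases "0 < s")
    case True
    \<comment> \<open>With w = s z the Jacobian s^n times |w| / s^2 = |z| / s leaves the weight
      s^(n-1).\<close>
    have "(\<integral>w. h s w \<partial>lborel) = \<bar>s\<bar> ^ DIM(real^'n) * (\<integral>z. h s (0 + s *\<^sub>R z) \<partial>lborel)"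
      using True unfolding h_def by (intro lebesgue_integral_affine) auto
    also have "\<dots> = (\<integral>z. s ^ CARD('n) * h s (s *\<^sub>R z) \<partial>lborel)"
      using True by simp
    also have "\<dots> = (\<integral>z. g z s \<partial>lborel)"
      using True by (intro Bochner_Integration.integral_cong refl)
        (simp add: g_def h_def power_card_eq power2_eq_square indicator_def)
    finally show ?thesis by simp
  next
    case False
    \<comment> \<open>The interval in \<open>g\<close> contains s = 0, the one in \<open>h\<close>
      does not; at s = 0 the weight 0^(n-1) is 0 because n >= 2.\<close>
    then show ?thesis using n2 by (cases "s = 0") (auto simp: g_def h_def)
  qed
  have "(\<integral>z. e' (norm z) * norm z * P x 0 z \<partial>lborel) = (\<integral>z. (\<integral>s. g z s \<partial>lborel) \<partial>lborel)"
  proof (rule Bochner_Integration.integral_cong[OF refl])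
    fix z :: "real^'n"
    show "e' (norm z) * norm z * P x 0 z = (\<integral>s. g z s \<partial>lborel)"
    proof (cases "1 \<le> norm z")
      case True
      have "(\<integral>s. g z s \<partial>lborel) = (\<integral>s. (e' (norm z) * norm z) * (indicator {0..S} s *\<^sub>R (\<psi> (x + s *\<^sub>R z) * (0 + s) ^ (CARD('n) - 1))) \<partial>lborel)"
        by (simp add: g_def mult_ac)
      also have "\<dots> = e' (norm z) * norm z * P x 0 z"
        unfolding P_truncate[OF True] set_lebesgue_integral_def S_def by (rule integral_mult_right_zero)
      finally show ?thesis by simp
    qed (use deriv_eq_0[of "norm z"] in \<open>simp add: g_def\<close>)
  qed
  also have "\<dots> = (\<integral>s. (\<integral>z. g z s \<partial>lborel) \<partial>lborel)"
    by (rule lborel_pair.Fubini_integral[OF g_int, symmetric])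
  also have "\<dots> = (\<integral>s. (\<integral>w. h s w \<partial>lborel) \<partial>lborel)"
    by (simp only: gh)
  also have "\<dots> = (\<integral>w. (\<integral>s. h s w \<partial>lborel) \<partial>lborel)"
    by (rule lborel_pair.Fubini_integral[OF h_int])
  also have "\<dots> = (\<integral>w. \<psi> (x + w) \<partial>lborel)"
  proof (rule integral_cong_AE)
    show "(\<lambda>w. \<integral>s. h s w \<partial>lborel) \<in> borel_measurable lborel"
      using h_meas by (rule lborel.borel_measurable_lebesgue_integral)
    have "AE w in lborel. w \<noteq> (0::real^'n)" by (rule AE_lborel_singleton)
    then show "AE w in lborel. (\<integral>s. h s w \<partial>lborel) = \<psi> (x + w)"
    proof eventually_elim
      fix w :: "real^'n" assume "w \<noteq> 0"
      show "(\<integral>s. h s w \<partial>lborel) = \<psi> (x + w)"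
      proof (cases "norm w < S")
        case True
        then show ?thesis
          unfolding h_def by (subst integral_mult_left_zero, subst integral_cutoff_scales[OF \<open>w \<noteq> 0\<close> True]) simp
      next
        case False
        then have "1 \<le> norm (x + w)"
          using norm_triangle_ineq2[of w "- x"] by (simp add: S_def add.commute)
        then show ?thesis by (simp add: h_def zero_outside)
      qed
    qed
  qed measurable
  also have "\<dots> = (\<integral>w. \<psi> w \<partial>lborel)" by (rule integral_psi_translate)
  finally show ?thesis .
qed

subsection \<open>Convergence of the potentials\<close>

lemma kernelN_bound:
  assumes "norm y \<le> R"
  shows "norm (kernelN \<psi> x y) \<le> B * (1 + R) ^ CARD('n) * (1 / norm (x - y) ^ (CARD('n) - 1))"
proof (cases "x = y")
  case True
  have "0 \<le> R" using assms norm_ge_zero order_trans by blast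
  with True show ?thesis using B_nonneg by (simp add: kernelN_eq)
next
  case False
  have "norm (kernelN \<psi> x y) \<le> B * ((1 + R) / norm (x - y)) ^ CARD('n) * norm (x - y)"
    unfolding kernelN_eq norm_scaleR using J_bound[OF assms False] by (intro mult_right_mono) auto
  also have "\<dots> = B * (1 + R) ^ CARD('n) * (1 / norm (x - y) ^ (CARD('n) - 1))"
    using False by (simp add: power_divide power_card_eq[of "norm (x - y)"])
  finally show ?thesis .
qed

lemma measurable_kernelN [measurable]: "kernelN \<psi> x \<in> borel_measurable borel"
proof -
  have "kernelN \<psi> x = (\<lambda>y. J x y *\<^sub>R (x - y))" by (simp add: kernelN_eq fun_eq_iff)
  then show ?thesis by simp
qed

text \<open>The error has the factor \<open>e - 1\<close>, which is at most 3 in absolute value and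
  vanishes for |x - y| >= 2 eps. Integrating the singularity over that ball gives a bound free of x,
  hence uniformity.\<close>

lemma regularization_error:
  fixes F :: "real^'n \<Rightarrow> real"
  assumes \<Omega>: "\<Omega> \<in> sets lebesgue" "\<Omega> \<subseteq> cball 0 R" and "0 \<le> R"
    and F: "F \<in> borel_measurable (lebesgue_on \<Omega>)"
    and C: "AE y in lebesgue_on \<Omega>. \<bar>F y\<bar> \<le> C" "0 \<le> C" and "0 < \<epsilon>"
  shows "norm ((LINT y|lebesgue_on \<Omega>. (F y * e (norm (x - y) / \<epsilon>)) *\<^sub>R kernelN \<psi> x y)
      - (LINT y|lebesgue_on \<Omega>. F y *\<^sub>R kernelN \<psi> x y))
    \<le> 3 * C * (B * (1 + R) ^ CARD('n)) * (unit_ball_vol (real CARD('n)) * 2 ^ CARD('n) * (2 * \<epsilon>))"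
proof -
  let ?M = "lebesgue_on \<Omega>"
  define b where "b = B * (1 + R) ^ CARD('n)"
  have b: "0 \<le> b" using B_nonneg \<open>0 \<le> R\<close> by (simp add: b_def)
  define k where "k r y = indicator (ball x r) y * (1 / norm (x - y) ^ (CARD('n) - 1))" for r y
  have k0: "0 \<le> k r y" for r y by (simp add: k_def)
  have [measurable]: "F \<in> borel_measurable ?M" by (rule F)
  have [measurable]: "kernelN \<psi> x \<in> borel_measurable ?M" "(\<lambda>y. e (norm (x - y) / \<epsilon>)) \<in> borel_measurable ?M"
    by (intro measurable_lebesgue_on_borel; measurable)+
  have k_lborel: "integrable lborel (k r)" if "0 \<le> r" for r
    unfolding k_def by (rule integrable_singular_kernel_ball[OF that])
  then have k_leb: "integrable lebesgue (k r)" if "0 \<le> r" for r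
    using that by (simp add: integrable_completion borel_measurable_integrable)
  have k_int: "integrable ?M (k r)" if "0 \<le> r" for r
    using integrable_mult_indicator[OF \<Omega>(1) k_leb[OF that]] \<Omega>(1)
    by (simp add: integrable_restrict_space)
  have k_le: "(LINT y|?M. k r y) \<le> unit_ball_vol (real CARD('n)) * 2 ^ CARD('n) * r" if "0 \<le> r" for r
  proof -
    have "(LINT y|?M. k r y) = (\<integral>y. indicator \<Omega> y *\<^sub>R k r y \<partial>lebesgue)"
      using \<Omega>(1) by (simp add: integral_restrict_space)
    also have "\<dots> \<le> (\<integral>y. k r y \<partial>lebesgue)"
      by (rule integral_mono'[OF k_leb[OF that]]) (auto simp: indicator_def k0)
    also have "\<dots> = (\<integral>y. k r y \<partial>lborel)"
      using borel_measurable_integrable[OF k_lborel[OF that]] by (rule integral_completion)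
    also have "\<dots> \<le> unit_ball_vol (real CARD('n)) * 2 ^ CARD('n) * r"
      unfolding k_def by (rule integral_singular_kernel_ball_le[OF that])
    finally show ?thesis .
  qed
  \<comment> \<open>Used twice: for the error, on the ball of radius 2 eps, and for integrability,
    on a ball around x large enough to contain \<open>\<Omega>\<close>.\<close>
  have bnd: "AE y in ?M. norm ((F y * t y) *\<^sub>R kernelN \<psi> x y) \<le> c * C * b * k r y"
    if "\<And>y. y \<in> \<Omega> \<Longrightarrow> \<bar>t y\<bar> \<le> c" "\<And>y. y \<in> \<Omega> \<Longrightarrow> y \<notin> ball x r \<Longrightarrow> t y = 0" "0 \<le> c" for t c r
    using C(1) AE_space[of ?M]
  proof eventually_elim
    fix y assume y: "\<bar>F y\<bar> \<le> C" "y \<in> space ?M"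
    then have "y \<in> \<Omega>" by simp
    show "norm ((F y * t y) *\<^sub>R kernelN \<psi> x y) \<le> c * C * b * k r y"
    proof (cases "y \<in> ball x r")
      case True
      have "norm ((F y * t y) *\<^sub>R kernelN \<psi> x y) \<le> (C * c) * (b * (1 / norm (x - y) ^ (CARD('n) - 1)))"
        unfolding norm_scaleR b_def using y that \<open>y \<in> \<Omega>\<close> \<Omega>(2) C(2)
        by (intro mult_mono abs_mult_le kernelN_bound) auto
      then show ?thesis using True by (simp add: k_def mult_ac)
    qed (use that \<open>y \<in> \<Omega>\<close> in \<open>simp add: k_def\<close>)
  qed
  have int: "integrable ?M (\<lambda>y. (F y * t y) *\<^sub>R kernelN \<psi> x y)"
    if [measurable]: "t \<in> borel_measurable ?M" and "\<And>y. \<bar>t y\<bar> \<le> 2" for t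
  proof (rule Bochner_Integration.integrable_bound)
    have r: "0 \<le> R + norm x + 1" using \<open>0 \<le> R\<close> by simp
    show "integrable ?M (\<lambda>y. 2 * C * b * k (R + norm x + 1) y)"
      by (intro integrable_mult_right k_int[OF r])
    have "y \<in> ball x (R + norm x + 1)" if "y \<in> \<Omega>" for y
      using norm_triangle_ineq4[of x y] that \<Omega>(2) by (auto simp: dist_norm)
    then have "AE y in ?M. norm ((F y * t y) *\<^sub>R kernelN \<psi> x y) \<le> 2 * C * b * k (R + norm x + 1) y"
      using that by (intro bnd) auto
    then show "AE y in ?M. norm ((F y * t y) *\<^sub>R kernelN \<psi> x y) \<le> norm (2 * C * b * k (R + norm x + 1) y)"
      by eventually_elim (auto intro: order_trans[OF _ abs_ge_self])
  qed measurable
  have 1: "integrable ?M (\<lambda>y. (F y * e (norm (x - y) / \<epsilon>)) *\<^sub>R kernelN \<psi> x y)"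
    by (rule int) (auto intro: e_bound)
  have 2: "integrable ?M (\<lambda>y. F y *\<^sub>R kernelN \<psi> x y)"
    using int[of "\<lambda>_. 1"] by simp
  have "norm ((LINT y|?M. (F y * e (norm (x - y) / \<epsilon>)) *\<^sub>R kernelN \<psi> x y) - (LINT y|?M. F y *\<^sub>R kernelN \<psi> x y))
    = norm (LINT y|?M. (F y * (e (norm (x - y) / \<epsilon>) - 1)) *\<^sub>R kernelN \<psi> x y)"
    by (subst Bochner_Integration.integral_diff[OF 1 2, symmetric]) (simp add: right_diff_distrib scaleR_diff_left)
  also have "\<dots> \<le> (LINT y|?M. 3 * C * b * k (2 * \<epsilon>) y)"
  proof (rule order_trans[OF integral_norm_bound integral_mono_AE'])
    show "integrable ?M (\<lambda>y. 3 * C * b * k (2 * \<epsilon>) y)"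
      using \<open>0 < \<epsilon>\<close> by (intro integrable_mult_right k_int) simp
    have "\<bar>e t - 1\<bar> \<le> 3" for t using e_bound[of t] by linarith
    moreover have "e (norm (x - y) / \<epsilon>) - 1 = 0" if "y \<notin> ball x (2 * \<epsilon>)" for y
      using that \<open>0 < \<epsilon>\<close> eq_1[of "norm (x - y) / \<epsilon>"] by (simp add: dist_norm pos_le_divide_eq)
    ultimately show "AE y in ?M. norm ((F y * (e (norm (x - y) / \<epsilon>) - 1)) *\<^sub>R kernelN \<psi> x y) \<le> 3 * C * b * k (2 * \<epsilon>) y"
      by (intro bnd) auto
  qed (use C(2) b k0 in auto)
  also have "\<dots> = 3 * C * b * (LINT y|?M. k (2 * \<epsilon>) y)" by simp
  also have "\<dots> \<le> 3 * C * b * (unit_ball_vol (real CARD('n)) * 2 ^ CARD('n) * (2 * \<epsilon>))"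
    using C(2) b \<open>0 < \<epsilon>\<close> by (intro mult_left_mono k_le) auto
  finally show ?thesis unfolding b_def .
qed

lemma uniform_limit_regularization:
  fixes F :: "real^'n \<Rightarrow> real"
  assumes "\<Omega> \<in> sets lebesgue" "\<Omega> \<subseteq> cball 0 R" "0 \<le> R"
    and "F \<in> borel_measurable (lebesgue_on \<Omega>)" "AE y in lebesgue_on \<Omega>. \<bar>F y\<bar> \<le> C"
  shows "uniform_limit UNIV (\<lambda>\<epsilon> x. LINT y|lebesgue_on \<Omega>. (F y * e (norm (x - y) / \<epsilon>)) *\<^sub>R kernelN \<psi> x y)
      (\<lambda>x. LINT y|lebesgue_on \<Omega>. F y *\<^sub>R kernelN \<psi> x y) (at_right 0)"
  unfolding uniform_limit_iff
proof (intro allI impI)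
  fix d :: real assume "0 < d"
  define Q where "Q = 3 * \<bar>C\<bar> * (B * (1 + R) ^ CARD('n)) * (unit_ball_vol (real CARD('n)) * 2 ^ CARD('n) * 2)"
  have Q: "0 \<le> Q" using B_nonneg assms(3) by (simp add: Q_def)
  have C: "AE y in lebesgue_on \<Omega>. \<bar>F y\<bar> \<le> \<bar>C\<bar>"
    using assms(5) by eventually_elim auto
  \<comment> \<open>\<open>Q\<close> may be 0, hence the denominator \<open>Q + 1\<close>.\<close>
  have "\<forall>\<^sub>F \<epsilon> in at_right 0. \<epsilon> < d / (Q + 1)" "\<forall>\<^sub>F \<epsilon> in at_right 0. (0::real) < \<epsilon>"
    using \<open>0 < d\<close> Q by (auto intro!: order_tendstoD(2)[OF ident_at_right_0] eventually_at_right_less)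
  then show "\<forall>\<^sub>F \<epsilon> in at_right 0. \<forall>x\<in>UNIV. dist (LINT y|lebesgue_on \<Omega>. (F y * e (norm (x - y) / \<epsilon>)) *\<^sub>R kernelN \<psi> x y)
      (LINT y|lebesgue_on \<Omega>. F y *\<^sub>R kernelN \<psi> x y) < d"
  proof eventually_elim
    fix \<epsilon> :: real assume \<epsilon>: "\<epsilon> < d / (Q + 1)" "0 < \<epsilon>"
    have "Q * \<epsilon> < d" using \<epsilon> Q by (simp add: pos_less_divide_eq algebra_simps)
    then show "\<forall>x\<in>UNIV. dist (LINT y|lebesgue_on \<Omega>. (F y * e (norm (x - y) / \<epsilon>)) *\<^sub>R kernelN \<psi> x y)
      (LINT y|lebesgue_on \<Omega>. F y *\<^sub>R kernelN \<psi> x y) < d"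
      using regularization_error[OF assms(1-4) C _ \<epsilon>(2)]
      by (auto simp: dist_norm Q_def mult_ac intro: le_less_trans)
  qed
qed

lemma divergence_regularization_tendsto:
  fixes F :: "real^'n \<Rightarrow> real"
  assumes n2: "2 \<le> CARD('n)" and \<Omega>: "open \<Omega>" "\<Omega> \<subseteq> cball 0 R" and "0 \<le> R"
    and F: "continuous_on (closure \<Omega>) F" and x: "x \<in> \<Omega>"
  shows "((\<lambda>\<epsilon>. divergence (\<lambda>x. LINT y|lebesgue_on \<Omega>. (F y * e (norm (x - y) / \<epsilon>)) *\<^sub>R kernelN \<psi> x y) x) \<longlongrightarrow>
      - \<psi> x * (LINT y|lebesgue_on \<Omega>. F y) + F x * (LINT w|lborel. \<psi> w)) (at_right 0)"
proof -
  \<comment> \<open>Borel because F is continuous on the open set \<open>\<Omega>\<close>, bounded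
    because the closure of \<open>\<Omega>\<close> is compact.\<close>
  define f where "f y = indicator \<Omega> y *\<^sub>R F y" for y
  have "bounded \<Omega>" by (rule bounded_subset[OF bounded_cball \<Omega>(2)])
  then have "bounded (F ` closure \<Omega>)"
    by (intro compact_imp_bounded compact_continuous_image[OF F]) (simp add: compact_closure)
  then obtain C where C: "\<And>y. y \<in> closure \<Omega> \<Longrightarrow> \<bar>F y\<bar> \<le> C" unfolding bounded_iff by auto
  have C0: "0 \<le> C" using C[of x] x closure_subset[of \<Omega>] by force
  have F\<Omega>: "continuous_on \<Omega> F" by (rule continuous_on_subset[OF F closure_subset])
  have f_meas [measurable]: "f \<in> borel_measurable borel"
    unfolding f_def by (rule borel_measurable_continuous_on_indicator[OF _ F\<Omega>]) (simp add: \<Omega>(1))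
  have f_bound: "\<bar>f y\<bar> \<le> C" for y
    using C[of y] C0 closure_subset[of \<Omega>] by (auto simp: f_def indicator_def)
  have f_supp: "f y = 0" if "R < norm y" for y
    using that \<Omega>(2) by (auto simp: f_def indicator_def)
  have f_cont: "isCont f x"
  proof -
    have "isCont F x" using F\<Omega> \<Omega>(1) x by (simp add: continuous_on_eq_continuous_at)
    moreover have "eventually (\<lambda>y. f y = F y) (nhds x)"
      by (rule eventually_mono[OF eventually_nhds_in_open[OF \<Omega>(1) x]]) (simp add: f_def)
    ultimately show ?thesis using isCont_cong[of f F x] by simp
  qed
  have f_int: "integrable lborel f"
  proof (rule Bochner_Integration.integrable_bound)
    show "integrable lborel (\<lambda>y::real^'n. C * indicator (cball 0 R) y)"
      by (intro integrable_mult_right integrable_indicator_cball)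
    show "AE y in lborel. norm (f y) \<le> norm (C * indicator (cball 0 R) y)"
      using f_bound f_supp C0 by (intro AE_I2) (auto simp: indicator_def)
  qed simp
  \<comment> \<open>Passes from Lebesgue measure on \<open>\<Omega>\<close> to Borel measure on the
    whole space, for integrands whose extension by zero is Borel.\<close>
  have to_lborel: "(LINT y|lebesgue_on \<Omega>. g y) = (\<integral>y. indicator \<Omega> y *\<^sub>R g y \<partial>lborel)"
    if "(\<lambda>y. indicator \<Omega> y *\<^sub>R g y) \<in> borel_measurable borel" for g :: "real^'n \<Rightarrow> 'b::{banach,second_countable_topology}"
    using \<Omega>(1) that by (simp add: integral_restrict_space integral_completion)
  have F_int: "(LINT y|lebesgue_on \<Omega>. F y) = (\<integral>y. f y \<partial>lborel)"
    using to_lborel[of F] f_meas unfolding f_def by simp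
  have fK: "f y *\<^sub>R K \<epsilon> x y = indicator \<Omega> y *\<^sub>R ((F y * e (norm (x - y) / \<epsilon>)) *\<^sub>R kernelN \<psi> x y)" for \<epsilon> x y
    by (simp add: f_def K_def kernelN_eq mult_ac)
  have v: "(\<lambda>x. LINT y|lebesgue_on \<Omega>. (F y * e (norm (x - y) / \<epsilon>)) *\<^sub>R kernelN \<psi> x y) = (\<lambda>x. \<integral>y. f y *\<^sub>R K \<epsilon> x y \<partial>lborel)" for \<epsilon>
  proof
    fix x :: "real^'n"
    have "(\<lambda>y. f y *\<^sub>R K \<epsilon> x y) \<in> borel_measurable borel" by measurable
    then show "(LINT y|lebesgue_on \<Omega>. (F y * e (norm (x - y) / \<epsilon>)) *\<^sub>R kernelN \<psi> x y) = (\<integral>y. f y *\<^sub>R K \<epsilon> x y \<partial>lborel)"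
      unfolding fK by (rule to_lborel)
  qed
  have "((\<lambda>\<epsilon>. - (\<psi> x * (\<integral>y. f y * e (norm (x - y) / \<epsilon>) \<partial>lborel))
      + (\<integral>y. f y * (e' (norm (x - y) / \<epsilon>) * (norm (x - y) / \<epsilon>) * J x y) \<partial>lborel)) \<longlongrightarrow>
      - (\<psi> x * (\<integral>y. f y \<partial>lborel)) + f x * (\<integral>z. e' (norm z) * norm z * P x 0 z \<partial>lborel)) (at_right 0)"
    by (intro tendsto_intros bulk_term_tendsto f_int concentrated_term_tendsto[OF f_meas f_bound f_cont])
  moreover have "\<forall>\<^sub>F \<epsilon> in at_right 0. - (\<psi> x * (\<integral>y. f y * e (norm (x - y) / \<epsilon>) \<partial>lborel))
      + (\<integral>y. f y * (e' (norm (x - y) / \<epsilon>) * (norm (x - y) / \<epsilon>) * J x y) \<partial>lborel)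
     = divergence (\<lambda>x. \<integral>y. f y *\<^sub>R K \<epsilon> x y \<partial>lborel) x"
    using eventually_at_right_less[of 0] order_tendstoD(2)[OF ident_at_right_0 zero_less_one]
    by eventually_elim
       (rule divergence_regularized[OF f_meas f_bound f_supp \<open>0 \<le> R\<close>, symmetric], auto)
  ultimately have "((\<lambda>\<epsilon>. divergence (\<lambda>x. \<integral>y. f y *\<^sub>R K \<epsilon> x y \<partial>lborel) x) \<longlongrightarrow>
      - (\<psi> x * (\<integral>y. f y \<partial>lborel)) + f x * (\<integral>z. e' (norm z) * norm z * P x 0 z \<partial>lborel)) (at_right 0)"
    by (rule Lim_transform_eventually)
  then show ?thesis
    using x by (simp add: v F_int integral_radial_average[OF n2] f_def)
qed

end

section \<open>From the hypotheses on \<open>\<psi>\<close> and \<open>\<eta>\<close> to the two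
  claims\<close>

theorem theorem10:
  fixes \<psi> :: "real^'n \<Rightarrow> real"
    and \<Omega> :: "(real^'n) set"
    and F :: "real^'n \<Rightarrow> real"
    and \<eta> :: "real \<Rightarrow> real"
    and q :: real
  assumes n2: "CARD('n) \<ge> 2"
    and psi_smooth: "smooth_on UNIV \<psi>"
    and psi_cpt: "compact (closure (support_on UNIV \<psi>))"
    and psi_supp: "closure (support_on UNIV \<psi>) \<subseteq> ball 0 1"
    and psi_nz: "\<exists>x. \<psi> x \<noteq> 0"
    and Omega_open: "open \<Omega>" and Omega_bdd: "bounded \<Omega>"
    and Omega_star: "\<forall>p\<in>cball 0 1. star_shaped_wrt \<Omega> p"
    and q: "q > real CARD('n)"
    and F_meas: "F \<in> borel_measurable (lebesgue_on \<Omega>)"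
    and F_Lq: "integrable (lebesgue_on \<Omega>) (\<lambda>y. \<bar>F y\<bar> powr q)"
    and eta_smooth: "smooth_on_real {0<..} \<eta>"
    and eta0: "\<forall>t\<in>{0..1}. \<eta> t = 0"
    and eta1: "\<forall>t\<ge>2. \<eta> t = 1"
    and eta_deriv: "\<forall>t>0. \<bar>deriv \<eta> t\<bar> \<le> 2"
  defines "v \<equiv> (\<lambda>x. LINT y|lebesgue_on \<Omega>. F y *\<^sub>R kernelN \<psi> x y)"
    and "v\<epsilon> \<equiv> (\<lambda>\<epsilon> x. LINT y|lebesgue_on \<Omega>. (F y * \<eta> (norm (x - y) / \<epsilon>)) *\<^sub>R kernelN \<psi> x y)"
  shows "((\<exists>C. AE y in lebesgue_on \<Omega>. \<bar>F y\<bar> \<le> C) \<longrightarrow> uniform_limit UNIV v\<epsilon> v (at_right 0))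
       \<and> (((LINT x|lborel. \<psi> x) = 1 \<and> continuous_on (closure \<Omega>) F) \<longrightarrow>
           (\<forall>x\<in>\<Omega>. ((\<lambda>\<epsilon>. divergence (v\<epsilon> \<epsilon>) x) \<longlongrightarrow>
                     - \<psi> x * (LINT y|lebesgue_on \<Omega>. F y) + F x) (at_right 0)))"
proof -
  define e where "e t = (if 0 < t then \<eta> t else 0)" for t
  define e' where "e' t = (if 0 < t then deriv \<eta> t else 0)" for t
  obtain \<psi>' B L where "bump \<psi> \<psi>' B L"
    using smooth_on_imp_bump[OF psi_smooth psi_supp] .
  moreover have "cutoff e e'"
    unfolding e_def[abs_def] e'_def[abs_def]
    by (rule smooth_on_real_imp_cutoff[OF eta_smooth eta0 eta1 eta_deriv])
  ultimately interpret bump_cutoff \<psi> \<psi>' B L e e'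
    by (rule bump_cutoff.intro)
  obtain R where R: "0 \<le> R" "\<Omega> \<subseteq> cball 0 R"
  proof -
    obtain R where "\<And>y. y \<in> \<Omega> \<Longrightarrow> norm y \<le> R" using Omega_bdd unfolding bounded_iff by blast
    then show thesis by (intro that[of "max R 0"]) (auto simp: le_max_iff_disj)
  qed
  have "\<Omega> \<in> sets lebesgue" using Omega_open by simp
  \<comment> \<open>For x = y the argument is 0, where \<open>\<eta>\<close> and its extension both
    vanish.\<close>
  have "\<eta> (norm (x - y) / \<epsilon>) = e (norm (x - y) / \<epsilon>)" if "0 < \<epsilon>" for \<epsilon> and x y :: "real^'n"
    using that eta0 by (cases "x = y") (auto simp: e_def)
  then have v\<epsilon>: "v\<epsilon> \<epsilon> = (\<lambda>x. LINT y|lebesgue_on \<Omega>. (F y * e (norm (x - y) / \<epsilon>)) *\<^sub>R kernelN \<psi> x y)" if "0 < \<epsilon>" for \<epsilon>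
    using that by (simp add: v\<epsilon>_def)
  have ev: "\<forall>\<^sub>F \<epsilon> in at_right 0. 0 < (\<epsilon>::real)" by (rule eventually_at_right_less)
  show ?thesis
  proof (intro conjI impI ballI)
    assume "\<exists>C. AE y in lebesgue_on \<Omega>. \<bar>F y\<bar> \<le> C"
    then obtain C where "AE y in lebesgue_on \<Omega>. \<bar>F y\<bar> \<le> C" ..
    from uniform_limit_regularization[OF \<open>\<Omega> \<in> sets lebesgue\<close> R(2,1) F_meas this]
    show "uniform_limit UNIV v\<epsilon> v (at_right 0)"
      unfolding v_def
      by (rule uniform_limit_cong[THEN iffD1, rotated -1]) (use ev in \<open>auto elim!: eventually_mono simp: v\<epsilon>\<close>)
  next
    fix x assume *: "(LINT x|lborel. \<psi> x) = 1 \<and> continuous_on (closure \<Omega>) F" and "x \<in> \<Omega>"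
    from divergence_regularization_tendsto[OF n2 Omega_open R(2,1) _ \<open>x \<in> \<Omega>\<close>, of F] *
    have "((\<lambda>\<epsilon>. divergence (\<lambda>x. LINT y|lebesgue_on \<Omega>. (F y * e (norm (x - y) / \<epsilon>)) *\<^sub>R kernelN \<psi> x y) x) \<longlongrightarrow>
        - \<psi> x * (LINT y|lebesgue_on \<Omega>. F y) + F x) (at_right 0)"
      by simp
    then show "((\<lambda>\<epsilon>. divergence (v\<epsilon> \<epsilon>) x) \<longlongrightarrow> - \<psi> x * (LINT y|lebesgue_on \<Omega>. F y) + F x) (at_right 0)"
      by (rule Lim_transform_eventually) (use ev in \<open>auto elim!: eventually_mono simp: v\<epsilon>\<close>)
  qed
qed

end
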